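(* Let $G$ be a non-elementary hyperbolic group, and let $X$ be a finite generating set for $G$. Then $\operatorname{dc}_X(G)=0$.
   Context: Hyperbolic means word-hyperbolic in the sense of Gromov; non-elementary means not virtually cyclic (in particular, infinite). Generating sets generate $G$ as a group. For a finite generating set $X$ of $G$, $|g|_X$ is the word length of $g\in G$ with respect to $X\cup X^{-1}$, and $\mathbb{B}_X(n)=\{g\in G : |g|_X\leq n\}$ is the ball of radius $n$ centered at $1$ in the Cayley graph of $G$ with respect to $X$. The degree of commutativity of $G$ with respect to $X$ is $$\operatorname{dc}_X(G)=\limsup_{n\to\infty}\frac{|\{(u,v)\in \mathbb{B}_X(n)^2 : uv=vu\}|}{|\mathbb{B}_X(n)|^2}.$$ *)

theory Defs
  imports "HOL-Algebra.Elementary_Groups" "HOL-Library.Extended_Real"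
begin

definition generating_set :: "('a, 'b) monoid_scheme \<Rightarrow> 'a set \<Rightarrow> bool" where
  "generating_set G X \<longleftrightarrow> X \<subseteq> carrier G \<and> generate G X = carrier G"

text \<open>Only meaningful for \<open>g\<close> in the subgroup generated by \<open>X\<close>; otherwise
  the set of admissible lengths is empty and \<open>LEAST\<close> is unspecified.\<close>

definition word_length :: "('a, 'b) monoid_scheme \<Rightarrow> 'a set \<Rightarrow> 'a \<Rightarrow> nat" where
  "word_length G X g =
     (LEAST n. \<exists>ws. set ws \<subseteq> X \<union> (m_inv G) ` X \<and> length ws = n
                  \<and> foldr (mult G) ws \<one>\<^bsub>G\<^esub> = g)"

definition word_ball :: "('a, 'b) monoid_scheme \<Rightarrow> 'a set \<Rightarrow> nat \<Rightarrow> 'a set" where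
  "word_ball G X n = {g \<in> carrier G. word_length G X g \<le> n}"

definition word_dist :: "('a, 'b) monoid_scheme \<Rightarrow> 'a set \<Rightarrow> 'a \<Rightarrow> 'a \<Rightarrow> nat" where
  "word_dist G X g h = word_length G X (inv\<^bsub>G\<^esub> g \<otimes>\<^bsub>G\<^esub> h)"

definition gromov_product :: "('a, 'b) monoid_scheme \<Rightarrow> 'a set \<Rightarrow> 'a \<Rightarrow> 'a \<Rightarrow> 'a \<Rightarrow> real" where
  "gromov_product G X w x y =
     (real (word_dist G X x w) + real (word_dist G X y w) - real (word_dist G X x y)) / 2"

text \<open>Gromov's definition: for some finite generating set, the group with its word
  metric is \<open>\<delta>\<close>-hyperbolic in terms of Gromov products, for some \<open>\<delta>\<close>. The property
  does not depend on the finite generating set, but that is a theorem and is not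
  built into the definition.\<close>

definition hyperbolic_group :: "('a, 'b) monoid_scheme \<Rightarrow> bool" where
  "hyperbolic_group G \<longleftrightarrow> group G \<and>
     (\<exists>Y. finite Y \<and> generating_set G Y \<and>
       (\<exists>\<delta>\<ge>0. \<forall>w\<in>carrier G. \<forall>x\<in>carrier G. \<forall>y\<in>carrier G. \<forall>z\<in>carrier G.
          gromov_product G Y w x z
            \<ge> min (gromov_product G Y w x y) (gromov_product G Y w y z) - \<delta>))"

text \<open>The cyclic subgroup may be trivial or finite, so every finite group is virtually cyclic.\<close>

definition virtually_cyclic :: "('a, 'b) monoid_scheme \<Rightarrow> bool" where
  "virtually_cyclic G \<longleftrightarrow>
     (\<exists>H. subgroup H G \<and> cyclic_group (G\<lparr>carrier := H\<rparr>) \<and> finite (rcosets\<^bsub>G\<^esub> H))"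

definition non_elementary :: "('a, 'b) monoid_scheme \<Rightarrow> bool" where
  "non_elementary G \<longleftrightarrow> \<not> virtually_cyclic G"

text \<open>The limit superior is taken in \<open>ereal\<close>, since \<open>real\<close> is not a complete lattice;
  for finite \<open>X\<close> the balls are finite and the sequence takes values in \<open>[0, 1]\<close>.\<close>

definition degree_of_commutativity :: "('a, 'b) monoid_scheme \<Rightarrow> 'a set \<Rightarrow> ereal" where
  "degree_of_commutativity G X =
     limsup (\<lambda>n. ereal (
       real (card {(u, v). u \<in> word_ball G X n \<and> v \<in> word_ball G X n
                           \<and> u \<otimes>\<^bsub>G\<^esub> v = v \<otimes>\<^bsub>G\<^esub> u})
       / (real (card (word_ball G X n)))\<^sup>2))"

end

theory Submission
  imports Defs
begin

text \<open>
  Let \<open>Y\<close> be a finite generating set whose word metric is \<open>\<delta>\<close>-hyperbolic. Only the growth of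
  balls refers to \<open>X\<close>; all geometry takes place in the metric of \<open>Y\<close>, and hyperbolicity with
  respect to \<open>X\<close> is never needed.

  An element \<open>u\<close> that is not conjugate to one of \<open>Y\<close>-length at most \<open>20\<delta>\<close> is conjugate, by an
  element no longer than \<open>u\<close>, to some \<open>s\<close> whose powers form a quasi-geodesic with uniform
  constants. Elements commuting with \<open>s\<close> stay uniformly close to this axis, so the centralizer of
  \<open>u\<close> meets the ball of radius \<open>n\<close> in \<open>O(n)\<close> elements.

  If \<open>u\<close> is conjugate to a short element, choose the conjugator \<open>g\<close> of minimal length; it then lies
  close to a \<open>Y\<close>-geodesic from \<open>1\<close> to \<open>u\<close>. Exponential divergence puts \<open>g\<close> within \<open>O(log n)\<close> of any
  \<open>X\<close>-path of length \<open>n\<close> from \<open>1\<close> to \<open>u\<close>, so \<open>u = x v x\<^sup>-\<^sup>1\<close> with \<open>x\<close> in the \<open>X\<close>-ball of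
  radius \<open>n div 2\<close> and \<open>v\<close> of \<open>Y\<close>-length \<open>O(log n)\<close>. Hence up to a polynomial factor there are
  at most as many such \<open>u\<close> in the ball of radius \<open>n\<close> as elements in the ball of radius \<open>n div 2\<close>.

  Finally, as \<open>G\<close> is not virtually cyclic, there are three long elements with pairwise bounded
  Gromov products. From every vertex at least two of them lead away from \<open>1\<close>. Iterating gives
  \<open>2^m\<close> extensions of each vertex, while a given vertex arises from only \<open>O(m)\<close> vertices, so some fixed
  thickening at least doubles every finite set. Thus the balls of \<open>X\<close> grow
  exponentially, which beats the polynomial factors.
\<close>

section \<open>Length functions on groups\<close>

text \<open>Word lengths are treated axiomatically so that two of them can live on the same group.
  \<open>len_step\<close> is the discrete form of the existence of geodesics.\<close>

locale length_group = group +
  fixes len :: "'a \<Rightarrow> nat"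
  assumes len_one: "len \<one> = 0"
    and len_zero: "x \<in> carrier G \<Longrightarrow> len x = 0 \<Longrightarrow> x = \<one>"
    and len_inv: "x \<in> carrier G \<Longrightarrow> len (inv x) = len x"
    and len_mult: "x \<in> carrier G \<Longrightarrow> y \<in> carrier G \<Longrightarrow> len (x \<otimes> y) \<le> len x + len y"
    and len_step: "x \<in> carrier G \<Longrightarrow> len x = Suc n \<Longrightarrow>
      \<exists>y\<in>carrier G. len y = n \<and> len (inv y \<otimes> x) = 1"
    and finite_ball: "finite {x \<in> carrier G. len x \<le> n}"
begin

definition ball :: "nat \<Rightarrow> 'a set" where
  "ball n = {x \<in> carrier G. len x \<le> n}"

definition ds :: "'a \<Rightarrow> 'a \<Rightarrow> nat" where
  "ds x y = len (inv x \<otimes> y)"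

definition gp :: "'a \<Rightarrow> 'a \<Rightarrow> 'a \<Rightarrow> real" where
  "gp w x y = (real (ds x w) + real (ds y w) - real (ds x y)) / 2"

section \<open>Metric identities and the Gromov product\<close>

lemma finite_ball_simp [simp]: "finite (ball n)"
  unfolding ball_def by (rule finite_ball)

lemma one_in_ball: "\<one> \<in> ball n"
  by (simp add: ball_def len_one)

lemma card_ball_pos: "card (ball n) > 0"
  using one_in_ball by (metis card_gt_0_iff empty_iff finite_ball_simp)

lemma ball_mono: "m \<le> n \<Longrightarrow> ball m \<subseteq> ball n"
  by (auto simp: ball_def)

lemma ds_sym: "x \<in> carrier G \<Longrightarrow> y \<in> carrier G \<Longrightarrow> ds x y = ds y x"
  unfolding ds_def using len_inv[of "inv x \<otimes> y"] by (simp add: inv_mult_group)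

lemma ds_refl [simp]: "x \<in> carrier G \<Longrightarrow> ds x x = 0"
  by (simp add: ds_def len_one)

lemma ds_one [simp]: "x \<in> carrier G \<Longrightarrow> ds \<one> x = len x" "x \<in> carrier G \<Longrightarrow> ds x \<one> = len x"
  by (simp_all add: ds_def len_inv)

lemma inv_mult_cancel [simp]:
  "x \<in> carrier G \<Longrightarrow> y \<in> carrier G \<Longrightarrow> inv x \<otimes> (x \<otimes> y) = y"
  "x \<in> carrier G \<Longrightarrow> y \<in> carrier G \<Longrightarrow> x \<otimes> (inv x \<otimes> y) = y"
  by (simp_all add: m_assoc[symmetric])

lemma ds_tri:
  assumes "x \<in> carrier G" "y \<in> carrier G" "z \<in> carrier G"
  shows "ds x z \<le> ds x y + ds y z"
  using len_mult[of "inv x \<otimes> y" "inv y \<otimes> z"] assms by (simp add: ds_def m_assoc)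

lemma ds_translate [simp]:
  assumes "g \<in> carrier G" "x \<in> carrier G" "y \<in> carrier G"
  shows "ds (g \<otimes> x) (g \<otimes> y) = ds x y"
  using assms by (simp add: ds_def inv_mult_group m_assoc)

lemma ds_mult_right [simp]: "x \<in> carrier G \<Longrightarrow> t \<in> carrier G \<Longrightarrow> ds x (x \<otimes> t) = len t"
  by (simp add: ds_def)

lemma gp_translate [simp]:
  assumes "g \<in> carrier G" "w \<in> carrier G" "x \<in> carrier G" "y \<in> carrier G"
  shows "gp (g \<otimes> w) (g \<otimes> x) (g \<otimes> y) = gp w x y"
  using assms by (simp add: gp_def)

lemma gp_translate_one:
  assumes "g \<in> carrier G" "x \<in> carrier G" "y \<in> carrier G"
  shows "gp \<one> (inv g \<otimes> x) (inv g \<otimes> y) = gp g x y"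
  using gp_translate[of "inv g" g x y] assms by simp

lemma gp_comm: "x \<in> carrier G \<Longrightarrow> y \<in> carrier G \<Longrightarrow> gp w x y = gp w y x"
  by (simp add: gp_def ds_sym)

text \<open>The distances to \<open>z\<close> cancel. This turns an upper bound for the product at
  one end of a side into a lower bound at the other end.\<close>

lemma gp_add:
  assumes "x \<in> carrier G" "y \<in> carrier G" "z \<in> carrier G"
  shows "gp x y z + gp y x z = ds x y"
  using ds_sym[OF assms(1,2)] ds_sym[OF assms(1,3)] ds_sym[OF assms(2,3)]
  by (simp add: gp_def field_simps)

lemma gp_nonneg:
  assumes "w \<in> carrier G" "x \<in> carrier G" "y \<in> carrier G"
  shows "gp w x y \<ge> 0"
  using ds_tri[OF assms(2,1,3)] ds_sym[OF assms(1,3)] by (simp add: gp_def)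

lemma gp_le:
  assumes "w \<in> carrier G" "x \<in> carrier G" "y \<in> carrier G"
  shows "gp w x y \<le> ds w x"
  using gp_add[OF assms] gp_nonneg[OF assms(2,1,3)] by simp

lemma gp_ge:
  assumes "w \<in> carrier G" "x \<in> carrier G" "y \<in> carrier G"
  shows "gp w x y \<ge> real (ds w x) - real (ds x y)"
  using gp_add[OF assms] gp_le[OF assms(2,3,1)] gp_comm[OF assms(1,3), of x] by simp

section \<open>Counting in balls and along geodesics\<close>

lemma card_ball_Suc: "card (ball (Suc n)) \<le> card (ball n) * card (ball 1)"
proof -
  have "ball (Suc n) \<subseteq> (\<lambda>(x, y). x \<otimes> y) ` (ball n \<times> ball 1)"
  proof
    fix x assume x: "x \<in> ball (Suc n)"
    show "x \<in> (\<lambda>(x, y). x \<otimes> y) ` (ball n \<times> ball 1)"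
    proof (cases "len x = Suc n")
      case True
      then obtain y where y: "y \<in> carrier G" "len y = n" "len (inv y \<otimes> x) = 1"
        using len_step x by (auto simp: ball_def)
      then have "x = (\<lambda>(x, y). x \<otimes> y) (y, inv y \<otimes> x)" "(y, inv y \<otimes> x) \<in> ball n \<times> ball 1"
        using x by (auto simp: ball_def)
      then show ?thesis by blast
    next
      case False
      then have "x = (\<lambda>(x, y). x \<otimes> y) (x, \<one>)" "(x, \<one>) \<in> ball n \<times> ball 1"
        using x by (auto simp: ball_def len_one)
      then show ?thesis by blast
    qed
  qed
  then have "card (ball (Suc n)) \<le> card ((\<lambda>(x, y). x \<otimes> y) ` (ball n \<times> ball 1))"
    by (intro card_mono) auto
  also have "\<dots> \<le> card (ball n \<times> ball 1)"
    by (intro card_image_le) auto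
  finally show ?thesis by (simp add: card_cartesian_product)
qed

lemma ball_0: "ball 0 = {\<one>}"
  by (auto simp: ball_def len_one len_zero)

lemma card_ball_le_power: "card (ball n) \<le> card (ball 1) ^ n"
proof (induction n)
  case (Suc n)
  have "card (ball (Suc n)) \<le> card (ball n) * card (ball 1)" by (rule card_ball_Suc)
  also have "\<dots> \<le> card (ball 1) ^ n * card (ball 1)"
    using Suc.IH by (rule mult_le_mono1)
  finally show ?case by (simp add: ac_simps)
qed (simp add: ball_0)

text \<open>Along a geodesic, \<open>f\<close> gains at most its maximum on the unit ball at each
  step. With a second length as \<open>f\<close>, this compares the two lengths up to a
  factor.\<close>

lemma subadditive_le_len:
  fixes f :: "'a \<Rightarrow> nat"
  assumes one: "f \<one> = 0"
    and mult: "\<And>x y. x \<in> carrier G \<Longrightarrow> y \<in> carrier G \<Longrightarrow> f (x \<otimes> y) \<le> f x + f y"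
  shows "\<exists>K. \<forall>x\<in>carrier G. f x \<le> K * len x"
proof (intro exI ballI)
  fix x assume "x \<in> carrier G"
  then show "f x \<le> Max (f ` ball 1) * len x"
  proof (induction "len x" arbitrary: x)
    case 0
    then show ?case using len_zero[of x] one by simp
  next
    case (Suc n)
    obtain y where y: "y \<in> carrier G" "len y = n" "len (inv y \<otimes> x) = 1"
      using len_step Suc by metis
    have "f x \<le> f y + f (inv y \<otimes> x)"
      using mult[of y "inv y \<otimes> x"] y Suc.prems by simp
    moreover have "f (inv y \<otimes> x) \<le> Max (f ` ball 1)"
    proof (intro Max_ge finite_imageI finite_ball_simp imageI)
      show "inv y \<otimes> x \<in> ball 1" using y Suc.prems by (simp add: ball_def)
    qed
    moreover have "f y \<le> Max (f ` ball 1) * len y"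
      using Suc.hyps(1)[of y] y by simp
    ultimately show ?case using y Suc.hyps(2) by (simp flip: Suc.hyps(2))
  qed
qed

text \<open>Append \<open>g\<close> to a geodesic ending at its predecessor; the triangle inequality
  through 1 rules out shortcuts. Beyond \<open>len g\<close> the sequence is only known to stay in
  the carrier.\<close>

lemma geodesic:
  assumes "g \<in> carrier G"
  obtains p where "\<And>i. p i \<in> carrier G" "p (len g) = g"
    "\<And>i j. i \<le> j \<Longrightarrow> j \<le> len g \<Longrightarrow> ds (p i) (p j) = j - i"
    "\<And>i. i \<le> len g \<Longrightarrow> len (p i) = i"
proof -
  have "\<exists>p. (\<forall>i. p i \<in> carrier G) \<and> p (len g) = g \<and>
    (\<forall>i j. i \<le> j \<longrightarrow> j \<le> len g \<longrightarrow> ds (p i) (p j) = j - i) \<and> (\<forall>i\<le>len g. len (p i) = i)"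
    using assms
  proof (induction "len g" arbitrary: g)
    case 0
    then show ?case by (intro exI[of _ "\<lambda>_. g"]) auto
  next
    case (Suc n)
    obtain y where y: "y \<in> carrier G" "len y = n" "len (inv y \<otimes> g) = 1"
      using len_step Suc by metis
    from Suc(1)[OF y(2)[symmetric] y(1)] obtain p where
      P: "(\<forall>i. p i \<in> carrier G) \<and> p n = y \<and>
        (\<forall>i j. i \<le> j \<longrightarrow> j \<le> n \<longrightarrow> ds (p i) (p j) = j - i) \<and> (\<forall>i\<le>n. len (p i) = i)"
      unfolding y(2) by (elim exE)
    then have p: "\<And>i. p i \<in> carrier G" "p n = y"
        "\<And>i j. i \<le> j \<Longrightarrow> j \<le> n \<Longrightarrow> ds (p i) (p j) = j - i" "\<And>i. i \<le> n \<Longrightarrow> len (p i) = i"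
      by simp_all
    define q where "q = p(Suc n := g)"
    have g: "ds (p i) g = Suc n - i" if "i \<le> n" for i
    proof -
      have "ds (p i) g \<le> ds (p i) (p n) + ds (p n) g"
        using ds_tri p(1) Suc by blast
      moreover have "ds \<one> g \<le> ds \<one> (p i) + ds (p i) g"
        using ds_tri p(1) Suc by blast
      ultimately show ?thesis
        using p(3)[of i n] p(1)[of i] p(4)[of i] p(2) that y(3) Suc(2,3) by (simp add: ds_def[of y g])
    qed
    have lg: "len g = Suc n" using Suc(2) by simp
    have q: "q i = p i" if "i \<le> n" for i using that by (simp add: q_def)
    have qg: "q (Suc n) = g" by (simp add: q_def)
    have "ds (q i) (q j) = j - i" if "i \<le> j" "j \<le> Suc n" for i j
    proof (cases "j = Suc n")
      case True
      then show ?thesis using g[of i] q[of i] qg that Suc(3) by (cases "i \<le> n") (auto simp: le_Suc_eq)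
    next
      case False
      then show ?thesis using p(3)[of i j] q[of i] q[of j] that by simp
    qed
    moreover have "len (q i) = i" if "i \<le> Suc n" for i
      using p(4)[of i] q[of i] qg lg that by (cases "i \<le> n") (auto simp: le_Suc_eq)
    moreover have "q i \<in> carrier G" for i
      using p(1) Suc(3) by (simp add: q_def)
    ultimately show ?case
      unfolding lg by (intro exI[of _ q] conjI allI impI) (simp_all add: qg)
  qed
  then obtain p where p: "(\<forall>i. p i \<in> carrier G) \<and> p (len g) = g \<and>
    (\<forall>i j. i \<le> j \<longrightarrow> j \<le> len g \<longrightarrow> ds (p i) (p j) = j - i) \<and> (\<forall>i\<le>len g. len (p i) = i)"
    by (elim exE)
  show ?thesis
    by (rule that[of p]) (use p in \<open>simp_all add: ball_def\<close>)
qed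

lemma geodesic_point:
  assumes "g \<in> carrier G" "j \<le> len g"
  obtains p where "p \<in> carrier G" "len p = j" "ds p g = len g - j"
proof -
  obtain p where p: "\<And>i. p i \<in> carrier G" "p (len g) = g"
    "\<And>i j. i \<le> j \<Longrightarrow> j \<le> len g \<Longrightarrow> ds (p i) (p j) = j - i"
    "\<And>i. i \<le> len g \<Longrightarrow> len (p i) = i"
    by (rule geodesic[OF assms(1)]) (rule that; assumption)
  show ?thesis
    by (rule that[of "p j"]) (use p(1,4) p(3)[of j "len g"] p(2) assms(2) in simp_all)
qed

text \<open>Fix a representative of each fibre of \<open>f\<close>; by \<open>close\<close> the
  fibre lies in the translate of \<open>ball r\<close> centred there. In the applications
  \<open>f\<close> is the distance to a fixed point.\<close>

lemma card_level_le:
  assumes A: "A \<subseteq> carrier G" and f: "f ` A \<subseteq> V" "finite V"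
    and close: "\<And>x y. x \<in> A \<Longrightarrow> y \<in> A \<Longrightarrow> f x = f y \<Longrightarrow> ds x y \<le> r"
  shows "finite A \<and> card A \<le> card V * card (ball r)"
proof -
  define c where "c v = (SOME x. x \<in> A \<and> f x = v)" for v
  have c: "c (f x) \<in> A \<and> f (c (f x)) = f x" if "x \<in> A" for x
    unfolding c_def by (rule someI[of _ x]) (use that in auto)
  have sub: "A \<subseteq> (\<lambda>(v, b). c v \<otimes> b) ` (V \<times> ball r)"
  proof
    fix x assume x: "x \<in> A"
    define y where "y = c (f x)"
    have y: "y \<in> A" "f y = f x" using c[OF x] by (simp_all add: y_def)
    then have car: "x \<in> carrier G" "y \<in> carrier G" using x A by auto
    have "x = (\<lambda>(v, b). c v \<otimes> b) (f x, inv y \<otimes> x)"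
      using car by (simp add: y_def[symmetric])
    moreover have "inv y \<otimes> x \<in> ball r"
      using close[OF y(1) x y(2)] car by (simp add: ball_def ds_def)
    moreover have "f x \<in> V" using f(1) x by blast
    ultimately show "x \<in> (\<lambda>(v, b). c v \<otimes> b) ` (V \<times> ball r)"
      by blast
  qed
  have "card A \<le> card ((\<lambda>(v, b). c v \<otimes> b) ` (V \<times> ball r))"
    using sub f by (intro card_mono) auto
  also have "\<dots> \<le> card (V \<times> ball r)"
    using f by (intro card_image_le) auto
  finally show ?thesis
    using finite_subset[OF sub] f by (simp add: card_cartesian_product)
qed

end

section \<open>Word lengths as length functions\<close>

text \<open>Concatenating and reversing shortest words gives the inequalities, deleting the last
  letter of one gives \<open>len_step\<close>, and balls are finite because there are finitely many
  words of bounded length.\<close>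

lemma length_group_word_length:
  fixes G (structure)
  assumes "group G" and fin: "finite X" and gen: "generating_set G X"
  shows "length_group G (word_length G X)"
proof -
  interpret group G by fact
  define A where "A = X \<union> (m_inv G) ` X"
  define ev where "ev ws = foldr (\<otimes>) ws \<one>" for ws
  have X: "X \<subseteq> carrier G" "generate G X = carrier G" using gen by (auto simp: generating_set_def)
  then have A: "A \<subseteq> carrier G" "finite A" using fin by (auto simp: A_def)
  have A_inv: "inv a \<in> A" if "a \<in> A" for a using that X by (force simp: A_def)
  have ev_closed: "ev ws \<in> carrier G" if "set ws \<subseteq> A" for ws
    using that A by (induction ws) (auto simp: ev_def)
  have ev_append: "ev (us @ vs) = ev us \<otimes> ev vs" if "set us \<subseteq> A" "set vs \<subseteq> A" for us vs
    using that(1)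
  proof (induction us)
    case Nil
    then show ?case using ev_closed[OF that(2)] by (simp add: ev_def)
  next
    case (Cons a us)
    then have "a \<in> carrier G" "ev us \<in> carrier G" "ev (us @ vs) = ev us \<otimes> ev vs"
      using A ev_closed by auto
    then show ?case using ev_closed[OF that(2)] by (simp add: ev_def m_assoc)
  qed
  have ev_single: "ev [a] = a" if "a \<in> A" for a using that A by (auto simp: ev_def)
  have ev_rev: "ev (rev (map (m_inv G) ws)) = inv (ev ws)" if "set ws \<subseteq> A" for ws
    using that
  proof (induction ws)
    case Nil
    then show ?case by (simp add: ev_def)
  next
    case (Cons a ws)
    have a: "a \<in> A" "set ws \<subseteq> A" "a \<in> carrier G" using Cons.prems A by auto
    have "set (rev (map (m_inv G) ws)) \<subseteq> A" "set [inv a] \<subseteq> A" using a A_inv by auto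
    from ev_append[OF this] have "ev (rev (map (m_inv G) (a # ws))) = inv (ev ws) \<otimes> inv a"
      using Cons.IH a ev_single[of "inv a"] A_inv by simp
    also have "\<dots> = inv (a \<otimes> ev ws)" using a ev_closed by (simp add: inv_mult_group)
    finally show ?case by (simp add: ev_def)
  qed
  have wl_def: "word_length G X g = (LEAST n. \<exists>ws. set ws \<subseteq> A \<and> length ws = n \<and> ev ws = g)" for g
    by (simp add: word_length_def A_def ev_def)
  have le: "word_length G X (ev ws) \<le> length ws" if "set ws \<subseteq> A" for ws
    unfolding wl_def by (rule Least_le) (use that in blast)
  have ex: "\<exists>ws. set ws \<subseteq> A \<and> ev ws = g" if "g \<in> carrier G" for g
  proof -
    have "g \<in> generate G X" using that X by simp
    then show ?thesis
    proof induction
      case one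
      then show ?case by (intro exI[of _ "[]"]) (simp add: ev_def)
    next
      case (incl h)
      then show ?case using ev_single[of h] by (intro exI[of _ "[h]"]) (simp add: A_def)
    next
      case (inv h)
      then show ?case using ev_single[of "inv h"] by (intro exI[of _ "[inv h]"]) (simp add: A_def)
    next
      case (eng h1 h2)
      then obtain us vs where "set us \<subseteq> A" "ev us = h1" "set vs \<subseteq> A" "ev vs = h2" by blast
      then show ?case using ev_append[of us vs] by (intro exI[of _ "us @ vs"]) simp
    qed
  qed
  have word: "\<exists>ws. set ws \<subseteq> A \<and> length ws = word_length G X g \<and> ev ws = g" if "g \<in> carrier G" for g
    unfolding wl_def
    by (rule LeastI_ex[of "\<lambda>n. \<exists>ws. set ws \<subseteq> A \<and> length ws = n \<and> ev ws = g"]) (use ex[OF that] in blast)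
  have inv_le: "word_length G X (inv x) \<le> word_length G X x" if x: "x \<in> carrier G" for x
  proof -
    obtain ws where ws: "set ws \<subseteq> A" "length ws = word_length G X x" "ev ws = x"
      using word[OF x] by blast
    then have "set (rev (map (m_inv G) ws)) \<subseteq> A" using A_inv by auto
    from le[OF this] show ?thesis using ev_rev[OF ws(1)] ws by simp
  qed
  have mult_le: "word_length G X (x \<otimes> y) \<le> word_length G X x + word_length G X y"
    if xy: "x \<in> carrier G" "y \<in> carrier G" for x y
  proof -
    obtain us where us: "set us \<subseteq> A" "length us = word_length G X x" "ev us = x"
      using word[OF xy(1)] by blast
    obtain vs where vs: "set vs \<subseteq> A" "length vs = word_length G X y" "ev vs = y"
      using word[OF xy(2)] by blast
    show ?thesis using le[of "us @ vs"] ev_append[of us vs] us vs by simp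
  qed
  show ?thesis
  proof
    show "word_length G X \<one> = 0" using le[of "[]"] by (simp add: ev_def)
  next
    fix x assume "x \<in> carrier G" "word_length G X x = 0"
    then show "x = \<one>" using word[of x] by (auto simp: ev_def)
  next
    fix x assume "x \<in> carrier G"
    then show "word_length G X (inv x) = word_length G X x"
      using inv_le[of x] inv_le[of "inv x"] by simp
  next
    fix x n assume x: "x \<in> carrier G" "word_length G X x = Suc n"
    obtain ws where ws: "set ws \<subseteq> A" "length ws = Suc n" "ev ws = x"
      using word[OF x(1)] x(2) by auto
    obtain vs a where va: "ws = vs @ [a]" using ws(2) by (metis length_Suc_conv_rev)
    have vs: "set vs \<subseteq> A" "length vs = n" "a \<in> A" using ws va by auto
    have c: "ev vs \<in> carrier G" "a \<in> carrier G" using vs A ev_closed by auto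
    have x_eq: "x = ev vs \<otimes> a" using ev_append[of vs "[a]"] ev_single vs va ws(3) by simp
    have "word_length G X (ev vs) \<le> n" "word_length G X a \<le> 1"
      using le[OF vs(1)] vs le[of "[a]"] ev_single[of a] by auto
    moreover have "Suc n \<le> word_length G X (ev vs) + word_length G X a"
      using mult_le[OF c] x x_eq by simp
    moreover have "inv (ev vs) \<otimes> x = a" using x_eq c by (simp add: m_assoc[symmetric])
    ultimately show "\<exists>y\<in>carrier G. word_length G X y = n \<and> word_length G X (inv y \<otimes> x) = 1"
      using c by (intro bexI[of _ "ev vs"]) auto
  next
    fix n
    have "{x \<in> carrier G. word_length G X x \<le> n} \<subseteq> ev ` {ws. set ws \<subseteq> A \<and> length ws \<le> n}"
    proof
      fix x assume x: "x \<in> {x \<in> carrier G. word_length G X x \<le> n}"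
      then obtain ws where "set ws \<subseteq> A" "length ws = word_length G X x" "ev ws = x"
        using word by blast
      then show "x \<in> ev ` {ws. set ws \<subseteq> A \<and> length ws \<le> n}" using x by auto
    qed
    then show "finite {x \<in> carrier G. word_length G X x \<le> n}"
      using finite_lists_length_le[OF A(2)] by (rule finite_subset[OF _ finite_imageI])
  qed (use mult_le in auto)
qed


section \<open>Hyperbolic length functions\<close>

text \<open>A positive integer \<delta> allows all thresholds and radii to be natural multiples of
  it.\<close>

locale hyperbolic_length_group = length_group +
  fixes \<delta> :: nat
  assumes delta_pos: "\<delta> \<ge> 1"
    and hyp: "w \<in> carrier G \<Longrightarrow> x \<in> carrier G \<Longrightarrow> y \<in> carrier G \<Longrightarrow> z \<in> carrier G \<Longrightarrow>
      min (gp w x y) (gp w y z) - \<delta> \<le> gp w x z"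
begin

lemma hyp2:
  assumes "w \<in> carrier G" "x \<in> carrier G" "y \<in> carrier G" "z \<in> carrier G" "t \<in> carrier G"
  shows "min (gp w x y) (min (gp w y z) (gp w z t)) - 2 * \<delta> \<le> gp w x t"
  using hyp[OF assms(1,2,3,5)] hyp[OF assms(1,3,4,5)] by linarith

text \<open>This is \<open>hyp\<close> at base point \<open>t\<close> with denominators cleared, a
  form symmetric in the four points.\<close>

lemma four_point:
  assumes "x \<in> carrier G" "y \<in> carrier G" "z \<in> carrier G" "t \<in> carrier G"
  shows "real (ds x y) + real (ds z t)
    \<le> max (real (ds x z) + real (ds y t)) (real (ds x t) + real (ds y z)) + 2 * \<delta>"
proof -
  have *: "min ((X + Z - A) / 2) ((Z + Y - B) / 2) - \<delta> \<le> (X + Y - C) / 2 \<Longrightarrow>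
    C + Z \<le> max (A + Y) (X + B) + 2 * \<delta>" for A B C X Y Z :: real
    by (simp add: min_def max_def field_simps split: if_splits)
  show ?thesis
    using *[OF hyp[OF assms(4,1,3,2), unfolded gp_def]] ds_sym[OF assms(2,3)] by simp
qed

text \<open>Since \<open>x\<close> and \<open>y\<close> are equally far from \<open>b\<close>, each
  of the two sums on the right of the four-point inequality is twice a product bounded by
  \<open>R\<close>, plus \<open>ds a b\<close>.\<close>

lemma close_of_same_level:
  fixes R :: real
  assumes "x \<in> carrier G" "y \<in> carrier G" "a \<in> carrier G" "b \<in> carrier G"
    and "gp x a b \<le> R" "gp y a b \<le> R" "ds x b = ds y b"
  shows "ds x y \<le> 2 * R + 2 * \<delta>"
  using four_point[OF assms(1,2,3,4)] assms(5-7)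
    ds_sym[OF assms(1,3)] ds_sym[OF assms(1,4)] ds_sym[OF assms(2,3)] ds_sym[OF assms(2,4)]
  by (simp add: gp_def)

text \<open>Bisection: one of the two pieces inherits the bound at the cost of \<delta>, and
  \<open>m\<close> cuts reduce \<open>2 ^ m\<close> edges to one. A small product at
  \<open>g\<close> places a short edge near \<open>g\<close>, so only an exponentially long path can
  avoid \<open>g\<close>.\<close>

lemma path_logarithmically_close:
  fixes A :: real
  assumes "\<And>i. p i \<in> carrier G" "g \<in> carrier G"
    and "1 \<le> n" "n \<le> 2 ^ m" "gp g (p 0) (p n) \<le> A"
  shows "\<exists>i<n. gp g (p i) (p (Suc i)) \<le> A + m * \<delta>"
  using assms
proof (induction m arbitrary: n p A)
  case 0
  then show ?case by (intro exI[of _ 0]) simp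
next
  case (Suc m)
  show ?case
  proof (cases "n \<le> 2 ^ m")
    case True
    from Suc.IH[OF Suc.prems(1-3) True Suc.prems(5)] obtain i
      where i: "i < n" "gp g (p i) (p (Suc i)) \<le> A + m * \<delta>" by blast
    have "real (m * \<delta>) \<le> real (Suc m * \<delta>)" by simp
    with i show ?thesis by (intro exI[of _ i] conjI) linarith+
  next
    case False
    define h :: nat where "h = 2 ^ m"
    have h: "1 \<le> h" "h < n" "n - h \<le> 2 ^ m" using False Suc.prems(4) by (auto simp: h_def)
    have "min (gp g (p 0) (p h)) (gp g (p h) (p n)) \<le> A + \<delta>"
      using hyp[of g "p 0" "p h" "p n"] Suc.prems by simp
    then consider "gp g (p 0) (p h) \<le> A + \<delta>" | "gp g (p h) (p n) \<le> A + \<delta>"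
      by linarith
    then show ?thesis
    proof cases
      case 1
      from Suc.IH[OF Suc.prems(1,2) h(1) _ 1] obtain i
        where i: "i < h" "gp g (p i) (p (Suc i)) \<le> A + \<delta> + m * \<delta>" by (auto simp: h_def)
      then show ?thesis using h by (intro exI[of _ i]) (simp add: algebra_simps)
    next
      case 2
      have "\<exists>i<n - h. gp g (p (h + i)) (p (h + Suc i)) \<le> A + \<delta> + m * \<delta>"
        using Suc.IH[of "\<lambda>i. p (h + i)" "n - h" "A + \<delta>"] Suc.prems(1,2) h 2 by simp
      then obtain i where "i < n - h" "gp g (p (h + i)) (p (h + Suc i)) \<le> A + \<delta> + m * \<delta>"
        by blast
      then show ?thesis by (intro exI[of _ "h + i"]) (simp add: algebra_simps)
    qed
  qed
qed

section \<open>Powers of long aligned elements and their centralizers\<close>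

context
  fixes s
  assumes s: "s \<in> carrier G" and aligned: "gp \<one> (inv s) s \<le> 4 * \<delta>" and long: "len s > 20 * \<delta>"
begin

text \<open>Small backtracking at every corner forces small backtracking globally. Translating the
  induction hypothesis by \<open>s\<close> shows that the next power agrees with
  \<open>s \<otimes> s\<close> for more than 15\<delta> as seen from \<open>s\<close>, while
  \<open>s \<otimes> s\<close> itself has product at most 4\<delta> with 1.\<close>

lemma gp_pow_Suc_le: "gp s \<one> (s [^] Suc n) \<le> 5 * \<delta>"
proof (induction n)
  case 0
  then show ?case using s by (simp add: gp_def)
next
  case (Suc n)
  let ?z = "s [^] Suc (Suc n)"
  have z: "?z = s \<otimes> s [^] Suc n"
    using s nat_pow_Suc2 by blast
  have "gp (s \<otimes> s) (s \<otimes> \<one>) (s \<otimes> s [^] Suc n) \<le> 5 * \<delta>"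
    using Suc s by (subst gp_translate) auto
  then have "gp (s \<otimes> s) s ?z \<le> 5 * \<delta>" using z s by simp
  moreover have "gp s (s \<otimes> s) ?z + gp (s \<otimes> s) s ?z = len s"
    using gp_add[of s "s \<otimes> s" ?z] s by simp
  moreover have "gp s \<one> (s \<otimes> s) = gp \<one> (inv s) s"
    using gp_translate[of s \<one> "inv s" s] s by simp
  moreover have "min (gp s \<one> ?z) (gp s ?z (s \<otimes> s)) - \<delta> \<le> gp s \<one> (s \<otimes> s)"
    using hyp s by simp
  moreover have "gp s ?z (s \<otimes> s) = gp s (s \<otimes> s) ?z"
    using gp_comm s by simp
  ultimately show ?case using aligned long delta_pos by (simp add: min_def split: if_splits)
qed

text \<open>Each further factor adds at least \<open>len s - 10 * \<delta>\<close>, which is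
  positive.\<close>

lemma len_pow_ge: "len (s [^] n) \<ge> n"
proof (induction n)
  case (Suc n)
  have "s [^] Suc n = s \<otimes> s [^] n" using s nat_pow_Suc2 by blast
  then have "ds s (s [^] Suc n) = len (s [^] n)"
    using s by simp
  then have "real (len s) + len (s [^] n) - len (s [^] Suc n) \<le> 10 * \<delta>"
    using gp_pow_Suc_le[of n] s ds_sym[of "s [^] Suc n" s] by (simp add: gp_def del: nat_pow_Suc)
  then show ?case using Suc long delta_pos by linarith
qed (simp add: len_one)

end

text \<open>Seen from 1, the negative power leaves in the direction of \<open>inv s\<close>, and
  \<open>inv s\<close> has product at most 5\<delta> with the positive power. The bounds for powers
  apply to \<open>inv s\<close> too, because alignment is symmetric.\<close>

lemma gp_pow_pow_inv:
  fixes k :: nat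
  assumes s: "s \<in> carrier G" and aligned: "gp \<one> (inv s) s \<le> 4 * \<delta>" and long: "len s > 20 * \<delta>"
  shows "gp \<one> (inv s [^] k) (s [^] k) \<le> 6 * \<delta>"
proof (cases k)
  case 0
  then show ?thesis by (simp add: gp_def)
next
  case (Suc n)
  have k: "inv s [^] k \<in> carrier G" "s [^] k \<in> carrier G" using s by auto
  have "gp (inv s) \<one> (inv s [^] k) \<le> 5 * \<delta>"
    unfolding Suc using s aligned long gp_comm[of s "inv s" \<one>]
    by (intro gp_pow_Suc_le) (auto simp: len_inv)
  moreover have "gp \<one> (inv s) (inv s [^] k) + gp (inv s) \<one> (inv s [^] k) = len s"
    using gp_add[of \<one> "inv s" "inv s [^] k"] s by (simp add: len_inv)
  moreover have "gp \<one> (inv s) (s [^] k) \<le> 5 * \<delta>"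
  proof -
    have "s [^] Suc k = s \<otimes> s [^] k" using s nat_pow_Suc2 by blast
    then have "gp \<one> (inv s) (s [^] k) = gp s \<one> (s [^] Suc k)"
      using gp_translate[of s \<one> "inv s" "s [^] k"] s by simp
    then show ?thesis using gp_pow_Suc_le[OF s aligned long, of k] by simp
  qed
  moreover have "min (gp \<one> (inv s) (inv s [^] k)) (gp \<one> (inv s [^] k) (s [^] k)) - \<delta>
      \<le> gp \<one> (inv s) (s [^] k)"
    using hyp s by simp
  ultimately show ?thesis using long delta_pos by (simp add: min_def split: if_splits)
qed

text \<open>An element \<open>c\<close> commuting with \<open>s\<close> moves both far powers of
  \<open>s\<close> only by \<open>len c\<close>, so it maps the long geodesic between them close to
  itself in the middle. Hence \<open>c\<close>, the image of 1, is close to this geodesic and is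
  determined up to a bounded error by its distance to one end.\<close>

lemma card_centralizer_le:
  assumes s: "s \<in> carrier G" and aligned: "gp \<one> (inv s) s \<le> 4 * \<delta>" and long: "len s > 20 * \<delta>"
  defines "A \<equiv> \<lambda>m. {c \<in> carrier G. c \<otimes> s = s \<otimes> c \<and> len c \<le> m}"
  shows "card (A m) \<le> (2 * m + 1) * card (ball (18 * \<delta>))"
proof -
  \<comment> \<open>The surplus 10\<delta> keeps the two outer products in \<open>hyp2\<close> above
    8\<delta>, so that the middle one has to be the small one.\<close>
  define k where "k = m + 10 * \<delta>"
  define y where "y = s [^] k"
  define y' where "y' = inv s [^] k"
  have y: "y \<in> carrier G" "y' \<in> carrier G" using s by (auto simp: y_def y'_def)
  have y_inv: "y' = inv y" using s by (simp add: y_def y'_def nat_pow_inv)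
  have ly: "len y \<ge> k" "len y' \<ge> k"
    using len_pow_ge[OF s aligned long] y by (simp_all add: y_inv len_inv) (simp_all add: y_def)
  have near: "gp c y' y \<le> 8 * \<delta> \<and> ds c y \<in> {len y - m..len y + m}" if "c \<in> A m" for c
  proof -
    have c: "c \<in> carrier G" "c \<otimes> s = s \<otimes> c" "len c \<le> m" using that by (auto simp: A_def)
    have comm: "c \<otimes> y = y \<otimes> c"
      unfolding y_def using group_commutes_pow[of s c k] c s by simp
    have comm': "c \<otimes> y' = y' \<otimes> c"
    proof -
      have "inv y \<otimes> (c \<otimes> y) \<otimes> inv y = inv y \<otimes> (y \<otimes> c) \<otimes> inv y" by (simp add: comm)
      then show ?thesis using c y by (simp add: y_inv m_assoc)
    qed
    have a: "ds (c \<otimes> y) y = len c" "ds (c \<otimes> y') y' = len c"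
      using c y ds_sym[of "y \<otimes> c" y] ds_sym[of "y' \<otimes> c" y'] by (simp_all add: comm comm')
    have b: "ds c (c \<otimes> y) = len y" "ds c (c \<otimes> y') = len y'" using c y by auto
    have "gp c (c \<otimes> y') (c \<otimes> y) \<le> 6 * \<delta>"
      using gp_translate[of c \<one> y' y] gp_pow_pow_inv[OF s aligned long, of k] c y
      by (simp add: y_def[symmetric] y'_def[symmetric])
    moreover have "gp c (c \<otimes> y') y' \<ge> real (len y') - len c"
      "gp c y (c \<otimes> y) \<ge> real (len y) - len c"
      using gp_ge[of c "c \<otimes> y'" y'] gp_ge[of c "c \<otimes> y" y] gp_comm[of y "c \<otimes> y" c] c y a b by simp_all
    moreover have "min (gp c (c \<otimes> y') y') (min (gp c y' y) (gp c y (c \<otimes> y))) - 2 * \<delta>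
        \<le> gp c (c \<otimes> y') (c \<otimes> y)"
      using hyp2 c y by simp
    ultimately have "gp c y' y \<le> 8 * \<delta>"
      using ly c(3) delta_pos unfolding k_def by (simp add: min_def split: if_splits)
    moreover have "ds c y \<le> len c + len y" "len y \<le> len c + ds c y"
      using ds_tri[of c \<one> y] ds_tri[of \<one> c y] c y by simp_all
    ultimately show ?thesis using c(3) by auto
  qed
  have "finite (A m) \<and> card (A m) \<le> card {len y - m..len y + m} * card (ball (18 * \<delta>))"
  proof (rule card_level_le[where f = "\<lambda>c. ds c y"])
    fix c c' assume c: "c \<in> A m" "c' \<in> A m" "ds c y = ds c' y"
    then have "c \<in> carrier G" "c' \<in> carrier G" by (auto simp: A_def)
    then have "real (ds c c') \<le> 2 * real (8 * \<delta>) + 2 * \<delta>"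
      using close_of_same_level[of c c' y' y "real (8 * \<delta>)"] near[OF c(1)] near[OF c(2)] c(3) y
      by simp
    then show "ds c c' \<le> 18 * \<delta>" by linarith
  qed (use near in \<open>auto simp: A_def\<close>)
  moreover have "card {len y - m..len y + m} \<le> 2 * m + 1" by simp
  ultimately show ?thesis
    by (meson le_trans mult_le_mono1)
qed

section \<open>Conjugation to a short or aligned element\<close>

text \<open>If \<open>u\<close> is long but not aligned, geodesics from 1 to \<open>u\<close> and to
  \<open>inv u\<close> start out together; conjugating by a point \<open>p\<close> of the common
  part shortens \<open>u\<close> by at least \<open>len p\<close>. So the conjugators accumulated by
  the induction have total length at most \<open>len u\<close>.\<close>

lemma conjugate_aligned:
  assumes "u \<in> carrier G"
  shows "\<exists>g\<in>carrier G. len g \<le> len u \<and>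
    (len (inv g \<otimes> u \<otimes> g) \<le> 20 * \<delta> \<or>
     gp \<one> (inv (inv g \<otimes> u \<otimes> g)) (inv g \<otimes> u \<otimes> g) \<le> 4 * \<delta>)"
  using assms
proof (induction "len u" arbitrary: u rule: less_induct)
  case less
  show ?case
  proof (cases "len u \<le> 20 * \<delta> \<or> gp \<one> (inv u) u \<le> 4 * \<delta>")
    case True
    then show ?thesis using less.prems by (intro bexI[of _ \<one>]) (auto simp: len_one)
  next
    case False
    note u = less.prems
    obtain p where p: "p \<in> carrier G" "len p = 4 * \<delta>" "ds p u = len u - 4 * \<delta>"
      using geodesic_point[OF u, of "4 * \<delta>"] False by auto
    \<comment> \<open>The translate of \<open>p\<close> lies on a geodesic from \<open>inv u\<close>
      to 1, and its distance to \<open>p\<close> is the length of the conjugate of \<open>u\<close>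
      by \<open>p\<close>.\<close>
    define y where "y = inv u \<otimes> p"
    have y: "y \<in> carrier G" using u p by (simp add: y_def)
    have ly: "len y = len u - 4 * \<delta>"
      using p u ds_sym[of p u] by (simp add: y_def ds_def)
    have dy: "ds (inv u) y = 4 * \<delta>" using p u by (simp add: y_def)
    have "gp \<one> p u = 4 * \<delta>" using p u False by (simp add: gp_def of_nat_diff)
    moreover have "gp \<one> (inv u) y = real (len u) - 4 * \<delta>"
      using u y ly dy False by (simp add: gp_def len_inv of_nat_diff)
    moreover have "gp \<one> u (inv u) > 4 * \<delta>"
      using False gp_comm u by simp
    moreover have "min (gp \<one> p u) (min (gp \<one> u (inv u)) (gp \<one> (inv u) y)) - 2 * \<delta> \<le> gp \<one> p y"
      using hyp2 u p y by simp
    ultimately have "gp \<one> p y \<ge> 2 * \<delta>" using False by simp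
    then have d: "ds p y \<le> len u - 4 * \<delta>"
      using p y ly False by (simp add: gp_def of_nat_diff)
    define v where "v = inv p \<otimes> u \<otimes> p"
    have v: "v \<in> carrier G" using u p by (simp add: v_def)
    have "ds y p = len v"
      using u p by (simp add: y_def v_def ds_def inv_mult_group m_assoc)
    then have lv: "len v + len p \<le> len u" using d p y False ds_sym[of y p] by linarith
    then have "len v < len u" using p(2) delta_pos by simp
    from less.hyps[OF this v] obtain g where g: "g \<in> carrier G" "len g \<le> len v"
      "len (inv g \<otimes> v \<otimes> g) \<le> 20 * \<delta> \<or> gp \<one> (inv (inv g \<otimes> v \<otimes> g)) (inv g \<otimes> v \<otimes> g) \<le> 4 * \<delta>"
      by blast
    have "inv (p \<otimes> g) \<otimes> u \<otimes> (p \<otimes> g) = inv g \<otimes> v \<otimes> g"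
      using u p g by (simp add: v_def inv_mult_group m_assoc)
    moreover have "len (p \<otimes> g) \<le> len u" using len_mult[of p g] p g lv by simp
    ultimately show ?thesis using g p by (intro bexI[of _ "p \<otimes> g"]) simp_all
  qed
qed

text \<open>For \<open>g\<close> of minimal length and \<open>s = g\<^sup>-\<^sup>1ug\<close>, minimality against \<open>gs\<close> and \<open>gs\<^sup>-\<^sup>1\<close> shows that
  \<open>s\<close> does not shift along a common initial part of the geodesics from \<open>\<one>\<close> to \<open>g\<^sup>-\<^sup>1\<close> and
  \<open>sg\<^sup>-\<^sup>1\<close>; cutting off that part would then shorten \<open>g\<close>.\<close>

lemma short_conjugator:
  assumes u: "u \<in> carrier G"
    and ex: "\<exists>g\<in>carrier G. len (inv g \<otimes> u \<otimes> g) \<le> 20 * \<delta>"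
  shows "\<exists>g\<in>carrier G. len (inv g \<otimes> u \<otimes> g) \<le> 20 * \<delta> \<and> gp g \<one> u \<le> 63 * \<delta> + 1"
proof -
  define short where "short = (\<lambda>g. g \<in> carrier G \<and> len (inv g \<otimes> u \<otimes> g) \<le> 20 * \<delta>)"
  have "\<exists>g. short g" using ex by (auto simp: short_def)
  then obtain g where "short g" and min: "\<forall>h. short h \<longrightarrow> len g \<le> len h"
    using ex_has_least_nat[of short _ len] by auto
  then have g: "g \<in> carrier G" "len (inv g \<otimes> u \<otimes> g) \<le> 20 * \<delta>"
    by (simp_all add: short_def)
  have least: "len g \<le> len h" if "h \<in> carrier G" "len (inv h \<otimes> u \<otimes> h) \<le> 20 * \<delta>" for h
    using min that by (simp add: short_def)
  define s where "s = inv g \<otimes> u \<otimes> g"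
  define P where "P = inv g"
  define Q where "Q = s \<otimes> P"
  have s: "s \<in> carrier G" "len s \<le> 20 * \<delta>" and P: "P \<in> carrier G" and Q: "Q \<in> carrier G"
    using g u by (auto simp: s_def P_def Q_def)
  have Q_eq: "Q = inv g \<otimes> u" using g u by (simp add: Q_def s_def P_def m_assoc)
  have lP: "len P = len g" using g by (simp add: P_def len_inv)
  have "gp g \<one> u \<le> 63 * \<delta> + 1"
  proof (rule ccontr)
    assume "\<not> ?thesis"
    moreover have "gp g \<one> u = gp \<one> P Q"
      using gp_translate_one[of g \<one> u] g u by (simp add: Q_eq P_def)
    ultimately have PQ: "gp \<one> P Q > 63 * \<delta> + 1" by simp
    \<comment> \<open>The assumed product of \<open>P\<close> and \<open>Q\<close> exceeds
      \<open>j\<close>, so the point \<open>h\<close> at level \<open>j\<close> lies in the part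
      that the geodesics to \<open>P\<close> and \<open>Q\<close> share up to a bounded
      error.\<close>
    define j where "j = 63 * \<delta> + 1"
    have j: "j \<le> len P" using PQ gp_le[of \<one> P Q] P Q by (simp add: j_def)
    obtain h where h: "h \<in> carrier G" "len h = j" "ds h P = len P - j"
      using geodesic_point[OF P j] by blast
    define h' where "h' = s \<otimes> h"
    have h': "h' \<in> carrier G" using h s by (simp add: h'_def)
    have sP: "len g \<le> ds s P"
    proof -
      have "inv (g \<otimes> s) \<otimes> u \<otimes> (g \<otimes> s) = s"
        using g u by (simp add: s_def inv_mult_group m_assoc)
      then have "len g \<le> len (g \<otimes> s)" using g s by (intro least) simp_all
      also have "\<dots> = ds P s" using g by (simp add: P_def ds_def)
      finally show ?thesis using ds_sym P s by simp
    qed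
    have lQ: "len g \<le> len Q"
    proof -
      have "inv (g \<otimes> inv s) \<otimes> u \<otimes> (g \<otimes> inv s) = s"
        using g u by (simp add: s_def inv_mult_group m_assoc)
      then have "len g \<le> len (g \<otimes> inv s)" using g s by (intro least) simp_all
      also have "\<dots> = len (inv Q)" using g s by (simp add: P_def Q_def inv_mult_group)
      finally show ?thesis using Q len_inv by simp
    qed
    have far: "ds h h' > 20 * \<delta>"
    proof (rule ccontr)
      assume "\<not> ?thesis"
      moreover have "inv (g \<otimes> h) \<otimes> u \<otimes> (g \<otimes> h) = inv h \<otimes> (s \<otimes> h)"
        using g u h by (simp add: s_def inv_mult_group m_assoc)
      ultimately have "len g \<le> len (g \<otimes> h)"
        using g h by (intro least) (simp_all add: ds_def h'_def)
      also have "\<dots> = ds P h" using g by (simp add: P_def ds_def)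
      also have "\<dots> = len g - j" using h P lP ds_sym by simp
      finally show False using j lP by (simp add: j_def)
    qed
    have d1: "ds s h' = j" "ds h' s = j"
      using h s h' ds_sym[of s h'] by (simp_all add: h'_def)
    have d2: "ds h' Q = len P - j" "ds Q h' = len P - j"
      using h s P h' Q ds_sym[of h' Q] by (simp_all add: h'_def Q_def)
    have "gp \<one> h P = j" using h P j by (simp add: gp_def of_nat_diff)
    moreover have "gp \<one> Q h' = (real (len Q) + real (len h') - (real (len P) - j)) / 2"
      using d2 Q h' j by (simp add: gp_def of_nat_diff)
    moreover have "min (gp \<one> h P) (min (gp \<one> P Q) (gp \<one> Q h')) - 2 * \<delta> \<le> gp \<one> h h'"
      using hyp2 h P Q h' by simp
    moreover have "gp \<one> h h' = (real j + len h' - ds h h') / 2"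
      using h h' by (simp add: gp_def)
    ultimately have d3: "real (ds h h') \<le> max 0 (real (len h') - j) + 4 * \<delta>"
      using PQ lQ lP by (simp add: j_def min_def max_def split: if_splits)
    have "len h' \<le> len s + j" using len_mult h s by (metis h'_def)
    then have d4: "ds h h' \<le> 24 * \<delta>" using d3 s by (simp add: max_def split: if_splits)
    have d5: "ds h' P \<le> 24 * \<delta> + (len P - j)"
      using ds_tri[of h' h P] d4 h h' P ds_sym[of h h'] by simp
    have "j \<le> len s + len h'"
      using ds_tri[of s \<one> h'] d1 s h' by simp
    \<comment> \<open>The first alternative of the maximum is at most
      \<open>len P + 44 * \<delta> - j\<close>, which is below \<open>len P + j\<close>. As
      \<open>ds s P\<close> is at least \<open>len P\<close>, the level of \<open>h'\<close> exceeds
      \<open>j\<close> by at most 2\<delta>, and \<open>d3\<close> then contradicts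
      \<open>far\<close>.\<close>
    moreover have "real (len h') + ds s P \<le> max (real (len s) + ds h' P) (real (len P) + j) + 2 * \<delta>"
      using four_point[of \<one> h' s P] s h' P d1 by simp
    ultimately have "real (len h') \<le> j + 2 * \<delta>"
      using sP lP d5 j s by (simp add: j_def max_def split: if_splits)
    then show False using d3 far delta_pos by (simp add: max_def split: if_splits)
  qed
  with g show ?thesis by blast
qed

end

section \<open>Doubling\<close>

text \<open>A shortest element of a right coset of the subgroup generated by \<open>w\<close>
  satisfies both inequalities. If all such elements were shorter than \<open>R\<close>, a ball would
  meet every coset and the cyclic subgroup would have finite index.\<close>

lemma (in length_group) exists_minimal_in_cosets:
  assumes nvc: "\<not> virtually_cyclic G" and w: "w \<in> carrier G"
  shows "\<exists>g\<in>carrier G. R \<le> len g \<and> len g \<le> len (w \<otimes> g) \<and> len g \<le> len (inv w \<otimes> g)"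
proof (rule ccontr)
  assume "\<not> ?thesis"
  then have small: "len g < R"
    if "g \<in> carrier G" "len g \<le> len (w \<otimes> g)" "len g \<le> len (inv w \<otimes> g)" for g
    using that by force
  define H where "H = generate G {w}"
  have H: "subgroup H G"
    unfolding H_def using w by (intro generate_is_subgroup) simp
  have wH: "w \<in> H" "inv w \<in> H"
    unfolding H_def by (auto intro: generate.incl generate.inv)
  have "cyclic_group (G\<lparr>carrier := H\<rparr>)"
    using cyclic_group_generated[of w] w by (simp add: subgroup_generated_def H_def)
  moreover have "rcosets H \<subseteq> (\<lambda>g. H #> g) ` ball R"
  proof
    fix C assume "C \<in> rcosets H"
    then obtain x where x: "x \<in> carrier G" "C = H #> x" by (auto simp: RCOSETS_def)
    have "x \<in> H #> x" using x H by (simp add: rcos_self)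
    then obtain g where g: "g \<in> H #> x" and least: "\<forall>h. h \<in> H #> x \<longrightarrow> len g \<le> len h"
      using ex_has_least_nat[of "\<lambda>g. g \<in> H #> x" x len] by auto
    have gc: "g \<in> carrier G" using g x H r_coset_subset_G subgroup.subset by blast
    have eq: "H #> x = H #> g" using repr_independence[OF g x(1) H] .
    have "w \<otimes> g \<in> H #> x" "inv w \<otimes> g \<in> H #> x"
      unfolding eq using wH gc H by (auto simp: r_coset_def)
    then have "len g < R" using small gc least by blast
    then show "C \<in> (\<lambda>g. H #> g) ` ball R"
      using eq x gc by (auto simp: ball_def)
  qed
  then have "finite (rcosets H)" by (rule finite_subset) simp
  ultimately show False using nvc H unfolding virtually_cyclic_def by blast
qed

context hyperbolic_length_group begin

text \<open>A word of length \<open>L\<close> occurring twice along a geodesic bounds a subword whose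
  square is almost geodesic.\<close>

lemma exists_aligned:
  assumes unbounded: "\<And>n. \<exists>g\<in>carrier G. len g \<ge> n" and L: "L > \<delta>"
  shows "\<exists>w\<in>carrier G. len w \<ge> L \<and> gp \<one> (inv w) w \<le> \<delta>"
proof -
  define N where "N = card (ball L)"
  obtain g where g: "g \<in> carrier G" "len g \<ge> Suc N * L" using unbounded by blast
  obtain p where p: "\<And>i. p i \<in> carrier G" "p (len g) = g"
    "\<And>i j. i \<le> j \<Longrightarrow> j \<le> len g \<Longrightarrow> ds (p i) (p j) = j - i"
    "\<And>i. i \<le> len g \<Longrightarrow> len (p i) = i"
    by (rule geodesic[OF g(1)]) (rule that; assumption)
  define a where "a k = inv (p (k * L)) \<otimes> p (k * L + L)" for k
  have bound: "k * L + L \<le> len g" if "k \<le> N" for k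
  proof -
    have "Suc k * L \<le> Suc N * L" using that by (intro mult_le_mono1) simp
    with g(2) have "Suc k * L \<le> len g" by (rule le_trans[rotated])
    then show ?thesis by (simp add: add.commute)
  qed
  have a: "a k \<in> carrier G" "len (a k) = L" if "k \<le> N" for k
    using p(1) p(3)[of "k * L" "k * L + L"] bound[OF that] by (simp_all add: a_def ds_def)
  have "a ` {..N} \<subseteq> ball L" using a by (auto simp: ball_def)
  then have "card (a ` {..N}) \<le> N" unfolding N_def by (intro card_mono) auto
  then have "\<not> inj_on a {..N}" using card_image[of a "{..N}"] by auto
  then obtain k l where kl: "k < l" "l \<le> N" "a k = a l"
    by (metis atMost_iff linorder_inj_onI' less_imp_le_nat)
  define i where "i = k * L"
  define j where "j = l * L"
  have "Suc k * L \<le> l * L" using kl by (intro mult_le_mono1) simp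
  then have ij: "i + L \<le> j" "j + L \<le> len g" using bound[OF kl(2)] by (auto simp: i_def j_def)
  define w where "w = inv (p i) \<otimes> p j"
  have w: "w \<in> carrier G" "len w = j - i"
    using p(1) p(3)[of i j] ij by (simp_all add: w_def ds_def)
  have k: "a k \<in> carrier G" "len (a k) = L" using a kl by simp_all
  \<comment> \<open>The repeated word both begins \<open>w\<close> and follows it on the geodesic.
    Hence \<open>a k\<close> has product 0 with \<open>inv w\<close> but product \<open>L\<close>
    with \<open>w\<close>, which separates \<open>w\<close> from \<open>inv w\<close>.\<close>
  have "w \<otimes> a k = inv (p i) \<otimes> p (j + L)"
    unfolding kl(3) using p(1) by (simp add: w_def a_def j_def m_assoc)
  then have "ds (inv w) (a k) = j + L - i"
    using p(1) p(3)[of i "j + L"] ij w by (simp add: ds_def)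
  then have "gp \<one> (inv w) (a k) = 0"
    using w k ij by (simp add: gp_def len_inv of_nat_diff)
  moreover have "ds (a k) w = j - (i + L)"
    unfolding w_def a_def i_def[symmetric] using p(1) p(3)[of "i + L" j] ij by simp
  then have "gp \<one> w (a k) = L"
    using w k ij ds_sym[of w "a k"] by (simp add: gp_def of_nat_diff)
  moreover have "min (gp \<one> (inv w) w) (gp \<one> w (a k)) - \<delta> \<le> gp \<one> (inv w) (a k)"
    using hyp w k by simp
  ultimately have "gp \<one> (inv w) w \<le> \<delta>" using L by (simp add: min_def split: if_splits)
  with w ij show ?thesis by (intro bexI[of _ w]) auto
qed

text \<open>As \<open>g\<close> is no closer to \<open>w\<close> than to 1, the points 1 and
  \<open>g\<close> lie on the same side as seen from \<open>w\<close>, whereas the power of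
  \<open>w\<close> lies on the other. So going from \<open>g\<close> to the power passes near
  \<open>w\<close>.\<close>

lemma gp_pow_le_of_minimal:
  fixes k :: nat
  assumes w: "w \<in> carrier G" "gp \<one> (inv w) w \<le> 4 * \<delta>" "len w > 20 * \<delta>"
    and g: "g \<in> carrier G" "len g \<le> len (inv w \<otimes> g)" and k: "k > 0"
  shows "gp \<one> g (w [^] k) \<le> len w + 6 * \<delta>"
proof -
  let ?z = "w [^] k"
  have z: "?z \<in> carrier G" using w by simp
  obtain n where "k = Suc n" using k by (cases k) auto
  then have "gp w \<one> ?z \<le> 5 * \<delta>" using gp_pow_Suc_le[OF w] by simp
  moreover have "min (gp w \<one> g) (gp w g ?z) - \<delta> \<le> gp w \<one> ?z"
    using hyp w g z by simp
  moreover have dg: "ds w g = len (inv w \<otimes> g)" by (simp add: ds_def)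
  then have "gp w \<one> g \<ge> len w / 2"
    using w g ds_sym[of g w] by (simp add: gp_def)
  ultimately have "gp w g ?z \<le> 6 * \<delta>" using w(3) by (simp add: min_def split: if_splits)
  then have "real (ds g ?z) \<ge> real (len g) + ds w ?z - 12 * \<delta>"
    using dg g ds_sym[of g w] ds_sym[of ?z w] w z by (simp add: gp_def)
  moreover have "len ?z \<le> len w + ds w ?z"
    using ds_tri[of \<one> w ?z] w z by simp
  ultimately show ?thesis using g z by (simp add: gp_def)
qed

text \<open>The directions are a positive and a negative power of an aligned \<open>w\<close>, and
  an element that neither \<open>w\<close> nor its inverse shortens. The bound \<open>C\<close> is
  fixed before \<open>D\<close>, so the lengths can later be taken large compared with it.\<close>

lemma exists_three_directions:
  assumes nvc: "\<not> virtually_cyclic G"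
  shows "\<exists>C. \<forall>D. \<exists>t :: nat \<Rightarrow> 'a. (\<forall>i. t i \<in> carrier G \<and> len (t i) \<ge> D) \<and>
    (\<forall>i<3. \<forall>j<3. i \<noteq> j \<longrightarrow> gp \<one> (t i) (t j) \<le> real C)"
proof -
  have "\<exists>g\<in>carrier G. len g \<ge> n" for n
    using exists_minimal_in_cosets[OF nvc, of \<one> n] by auto
  then obtain w where w: "w \<in> carrier G" "len w \<ge> 20 * \<delta> + 1" "gp \<one> (inv w) w \<le> \<delta>"
    using exists_aligned[of "20 * \<delta> + 1"] by auto
  have w': "gp \<one> (inv w) w \<le> 4 * \<delta>" "len w > 20 * \<delta>" using w by auto
  have wi: "inv w \<in> carrier G" "gp \<one> (inv (inv w)) (inv w) \<le> 4 * \<delta>" "len (inv w) > 20 * \<delta>"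
    using w w' gp_comm[of w "inv w" \<one>] by (simp_all add: len_inv)
  have "\<exists>t :: nat \<Rightarrow> 'a. (\<forall>i. t i \<in> carrier G \<and> len (t i) \<ge> D) \<and>
    (\<forall>i<3. \<forall>j<3. i \<noteq> j \<longrightarrow> gp \<one> (t i) (t j) \<le> real (len w + 6 * \<delta>))" for D
  proof -
    define a where "a = w [^] Suc D"
    define b where "b = inv w [^] Suc D"
    obtain g where g: "g \<in> carrier G" "D \<le> len g" "len g \<le> len (w \<otimes> g)"
      "len g \<le> len (inv w \<otimes> g)"
      using exists_minimal_in_cosets[OF nvc w(1), of D] by blast
    have ab: "a \<in> carrier G" "b \<in> carrier G" using w by (auto simp: a_def b_def)
    have l: "len a \<ge> D" "len b \<ge> D"
      using len_pow_ge[OF w(1) w', of "Suc D"] len_pow_ge[OF wi, of "Suc D"]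
      by (simp_all only: a_def b_def)
    have "gp \<one> b a \<le> len w + 6 * \<delta>"
      using gp_pow_pow_inv[OF w(1) w', of "Suc D"] by (simp only: a_def b_def)
    moreover have "gp \<one> g a \<le> len w + 6 * \<delta>"
      unfolding a_def using gp_pow_le_of_minimal[OF w(1) w' g(1) g(4), of "Suc D"] by simp
    moreover have "gp \<one> g b \<le> len w + 6 * \<delta>"
      unfolding b_def
      using gp_pow_le_of_minimal[OF wi g(1), of "Suc D"] g(3) w(1) by (simp add: len_inv)
    ultimately show ?thesis
      using g ab l gp_comm[of a b \<one>] gp_comm[of a g \<one>] gp_comm[of b g \<one>]
      by (intro exI[of _ "\<lambda>i. if i = 0 then a else if i = 1 then b else g"])
         (auto simp: numeral_3_eq_3 less_Suc_eq)
  qed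
  then show ?thesis by blast
qed

section \<open>Branching and doubling\<close>

context
  fixes t :: "nat \<Rightarrow> 'a" and C D K :: nat
  assumes t: "\<And>i. t i \<in> carrier G" and t_ge: "\<And>i. len (t i) \<ge> D" and t_le: "\<And>i. i < 3 \<Longrightarrow> len (t i) \<le> K"
    and div: "\<And>i j. i < 3 \<Longrightarrow> j < 3 \<Longrightarrow> i \<noteq> j \<Longrightarrow> gp \<one> (t i) (t j) \<le> C"
    and D: "D > 2 * C + 5 * \<delta>"
begin

text \<open>Two directions both turning back towards 1 would have a product above \<open>C\<close>
  at \<open>x\<close>, so at most one of the three is bad.\<close>

lemma two_good_directions:
  assumes x: "x \<in> carrier G"
  shows "\<exists>i<3. \<exists>j<3. i \<noteq> j \<and> gp x \<one> (x \<otimes> t i) \<le> C + \<delta> \<and> gp x \<one> (x \<otimes> t j) \<le> C + \<delta>"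
proof -
  define good where "good i \<longleftrightarrow> gp x \<one> (x \<otimes> t i) \<le> C + \<delta>" for i
  have one_bad: "good i \<or> good j" if "i < 3" "j < 3" "i \<noteq> j" for i j
  proof -
    have "gp x (x \<otimes> t i) (x \<otimes> t j) \<le> C"
      using gp_translate[of x \<one> "t i" "t j"] div[OF that] t x by simp
    moreover have "min (gp x (x \<otimes> t i) \<one>) (gp x \<one> (x \<otimes> t j)) - \<delta> \<le> gp x (x \<otimes> t i) (x \<otimes> t j)"
      using hyp t x by simp
    moreover have "gp x (x \<otimes> t i) \<one> = gp x \<one> (x \<otimes> t i)" using gp_comm t x by simp
    ultimately show ?thesis unfolding good_def by (simp add: min_def split: if_splits)
  qed
  have "good 0 \<or> good 1" "good 0 \<or> good 2" "good 1 \<or> good 2"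
    by (rule one_bad; simp)+
  then obtain i j :: nat where "i < 3" "j < 3" "i \<noteq> j" "good i" "good j"
    using that[of 0 1] that[of 0 2] that[of 1 2] by auto
  then show ?thesis unfolding good_def by blast
qed

text \<open>The step from \<open>x\<close> to \<open>x \<otimes> t i\<close> is long enough, by the
  choice of \<open>D\<close>, that small backtracking at both of its ends adds up to none in
  between. The bound \<open>C + 2 * \<delta>\<close> reproduces itself, so it serves as an induction
  invariant.\<close>

lemma extend_direction:
  assumes x: "x \<in> carrier G" and good: "gp x \<one> (x \<otimes> t i) \<le> C + \<delta>"
    and h: "h \<in> carrier G" "gp (x \<otimes> t i) \<one> h \<le> C + 2 * \<delta>"
  shows "gp x \<one> h \<le> C + 2 * \<delta>" "gp x (x \<otimes> t i) h \<ge> real D - C - 3 * \<delta>"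
proof -
  let ?y = "x \<otimes> t i"
  have y: "?y \<in> carrier G" "ds x ?y = len (t i)" using x t by auto
  have "gp ?y \<one> x + gp x \<one> ?y = len (t i)"
    using gp_add[of x ?y \<one>] gp_comm[of \<one> x ?y] gp_comm[of \<one> ?y x] x y by simp
  moreover have "min (gp ?y \<one> x) (gp ?y x h) - \<delta> \<le> gp ?y \<one> h"
    using hyp x y h by simp
  ultimately have "gp ?y x h \<le> C + 3 * \<delta>"
    using h good D t_ge[of i] by (simp add: min_def split: if_splits)
  moreover have "gp x ?y h + gp ?y x h = len (t i)"
    using gp_add[of x ?y h] x y h by simp
  ultimately show far: "gp x ?y h \<ge> real D - C - 3 * \<delta>" using t_ge[of i] by simp
  have "min (gp x \<one> h) (gp x h ?y) - \<delta> \<le> gp x \<one> ?y"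
    using hyp x y h by simp
  moreover have "gp x h ?y = gp x ?y h" using gp_comm y h by simp
  ultimately show "gp x \<one> h \<le> C + 2 * \<delta>"
    using far good D by (simp add: min_def split: if_splits)
qed

lemma exists_many_extensions:
  assumes "x \<in> carrier G"
  shows "\<exists>S\<subseteq>carrier G. finite S \<and> card S \<ge> 2 ^ m \<and>
    (\<forall>h\<in>S. gp x \<one> h \<le> C + 2 * \<delta> \<and> ds x h \<le> m * K)"
  using assms
proof (induction m arbitrary: x)
  case 0
  have "gp x \<one> x = 0" using 0 by (simp add: gp_def)
  then show ?case using 0 by (intro exI[of _ "{x}"]) simp
next
  case (Suc m)
  obtain i j where ij: "i < 3" "j < 3" "i \<noteq> j"
    and good: "gp x \<one> (x \<otimes> t i) \<le> C + \<delta>" "gp x \<one> (x \<otimes> t j) \<le> C + \<delta>"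
    using two_good_directions[OF Suc.prems] by blast
  have c: "x \<otimes> t i \<in> carrier G" "x \<otimes> t j \<in> carrier G" using Suc.prems t by auto
  obtain S where S: "S \<subseteq> carrier G" "finite S" "card S \<ge> 2 ^ m"
    and S': "\<forall>h\<in>S. gp (x \<otimes> t i) \<one> h \<le> C + 2 * \<delta> \<and> ds (x \<otimes> t i) h \<le> m * K"
    using Suc.IH[OF c(1)] by blast
  obtain T where T: "T \<subseteq> carrier G" "finite T" "card T \<ge> 2 ^ m"
    and T': "\<forall>h\<in>T. gp (x \<otimes> t j) \<one> h \<le> C + 2 * \<delta> \<and> ds (x \<otimes> t j) h \<le> m * K"
    using Suc.IH[OF c(2)] by blast
  \<comment> \<open>A common element would follow both \<open>t i\<close> and \<open>t j\<close>
    from \<open>x\<close> for a long time, although these two diverge within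
    \<open>C\<close>.\<close>
  have disj: "S \<inter> T = {}"
  proof (rule ccontr)
    assume "S \<inter> T \<noteq> {}"
    then obtain h where h: "h \<in> S" "h \<in> T" by blast
    then have hc: "h \<in> carrier G" using S by blast
    have "gp x (x \<otimes> t i) h \<ge> real D - C - 3 * \<delta>" "gp x (x \<otimes> t j) h \<ge> real D - C - 3 * \<delta>"
      using extend_direction(2)[OF Suc.prems good(1) hc] extend_direction(2)[OF Suc.prems good(2) hc]
        S' T' h by blast+
    moreover have "gp x (x \<otimes> t j) h = gp x h (x \<otimes> t j)" using gp_comm c hc by simp
    moreover have "min (gp x (x \<otimes> t i) h) (gp x h (x \<otimes> t j)) - \<delta> \<le> gp x (x \<otimes> t i) (x \<otimes> t j)"
      using hyp Suc.prems c hc by simp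
    moreover have "gp x (x \<otimes> t i) (x \<otimes> t j) \<le> C"
      using gp_translate[of x \<one> "t i" "t j"] div[OF ij] t Suc.prems by simp
    ultimately show False using D by (simp add: min_def split: if_splits)
  qed
  have "gp x \<one> h \<le> C + 2 * \<delta> \<and> ds x h \<le> Suc m * K" if "h \<in> S \<union> T" for h
  proof -
    obtain l where l: "l < 3" "gp x \<one> (x \<otimes> t l) \<le> C + \<delta>"
      "gp (x \<otimes> t l) \<one> h \<le> C + 2 * \<delta>" "ds (x \<otimes> t l) h \<le> m * K"
      using \<open>h \<in> S \<union> T\<close> ij good S' T' by blast
    have hc: "h \<in> carrier G" using S T that by blast
    have "ds x h \<le> len (t l) + ds (x \<otimes> t l) h"
      using ds_tri[of x "x \<otimes> t l" h] Suc.prems t hc by simp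
    then show ?thesis
      using extend_direction(1)[OF Suc.prems l(2) hc l(3)] l(4) t_le[OF l(1)] by simp
  qed
  moreover have "card (S \<union> T) \<ge> 2 ^ Suc m"
    using card_Un_disjoint[OF S(2) T(2) disj] S(3) T(3) by simp
  ultimately show ?case using S T by (intro exI[of _ "S \<union> T"]) auto
qed

end

text \<open>This bounds from how many vertices \<open>h\<close> can arise as an extension: their
  distances to \<open>h\<close> take at most \<open>Suc r\<close> values, and those at equal
  distance are mutually close.\<close>

lemma card_near_geodesic_le:
  assumes h: "h \<in> carrier G"
  shows "finite {x \<in> carrier G. gp x \<one> h \<le> real C \<and> ds x h \<le> r} \<and>
    card {x \<in> carrier G. gp x \<one> h \<le> real C \<and> ds x h \<le> r} \<le> Suc r * card (ball (2 * C + 2 * \<delta>))"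
    (is "finite ?A \<and> _")
proof -
  have "finite ?A \<and> card ?A \<le> card {..r} * card (ball (2 * C + 2 * \<delta>))"
  proof (rule card_level_le[where f = "\<lambda>x. ds x h"])
    fix x y assume "x \<in> ?A" "y \<in> ?A" "ds x h = ds y h"
    then have "real (ds x y) \<le> 2 * real C + 2 * \<delta>"
      using close_of_same_level[of x y \<one> h "real C"] h by simp
    then show "ds x y \<le> 2 * C + 2 * \<delta>" by linarith
  qed auto
  then show ?thesis by simp
qed

lemma exponential_beats_linear: "\<exists>m. 2 * (Suc (m * K) * B) \<le> 2 ^ m" for K B :: nat
proof -
  \<comment> \<open>With \<open>m = 2 * k\<close>, one factor \<open>2 ^ k\<close> absorbs the
    constant \<open>k\<close> and the other the linear term \<open>Suc k\<close>.\<close>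
  define k where "k = 4 * Suc K * B"
  have "2 * (Suc (2 * k * K) * B) \<le> 4 * Suc K * B * Suc k"
    by (simp add: algebra_simps)
  also have "\<dots> \<le> 2 ^ k * 2 ^ k"
    unfolding k_def[symmetric] by (intro mult_mono) (auto simp: Suc_le_eq less_imp_le)
  also have "\<dots> = 2 ^ (2 * k)" by (simp add: mult_2 power_add)
  finally show ?thesis by blast
qed

text \<open>Double counting of pairs of a vertex in \<open>F\<close> and one of its extensions: each
  vertex has at least \<open>2 ^ m\<close> extensions, and each extension comes from a number of
  vertices linear in \<open>m\<close>.\<close>

lemma doubling:
  assumes nvc: "\<not> virtually_cyclic G"
  shows "\<exists>r. \<forall>F. finite F \<longrightarrow> F \<subseteq> carrier G \<longrightarrow>
    2 * card F \<le> card ((\<lambda>(x, b). x \<otimes> b) ` (F \<times> ball r))"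
proof -
  obtain C where C: "\<And>D. \<exists>t :: nat \<Rightarrow> 'a. (\<forall>i. t i \<in> carrier G \<and> len (t i) \<ge> D) \<and>
    (\<forall>i<3. \<forall>j<3. i \<noteq> j \<longrightarrow> gp \<one> (t i) (t j) \<le> real C)"
    using exists_three_directions[OF nvc] by blast
  define D where "D = 2 * C + 5 * \<delta> + 1"
  obtain t :: "nat \<Rightarrow> 'a" where t: "\<And>i. t i \<in> carrier G" "\<And>i. len (t i) \<ge> D"
    and div: "\<And>i j. i < 3 \<Longrightarrow> j < 3 \<Longrightarrow> i \<noteq> j \<Longrightarrow> gp \<one> (t i) (t j) \<le> real C"
    using C[of D] by blast
  define K where "K = len (t 0) + len (t 1) + len (t 2)"
  have K: "len (t i) \<le> K" if "i < 3" for i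
    using that by (auto simp: K_def numeral_3_eq_3 less_Suc_eq numeral_2_eq_2)
  define C' where "C' = C + 2 * \<delta>"
  define B where "B = card (ball (2 * C' + 2 * \<delta>))"
  have B: "B > 0" unfolding B_def by (rule card_ball_pos)
  obtain m where m: "2 * (Suc (m * K) * B) \<le> 2 ^ m" using exponential_beats_linear by blast
  have "\<exists>S\<subseteq>carrier G. finite S \<and> card S \<ge> 2 ^ m \<and> (\<forall>h\<in>S. gp x \<one> h \<le> C' \<and> ds x h \<le> m * K)"
    if "x \<in> carrier G" for x
    using exists_many_extensions[of t D K C, OF t K div _ that] by (simp add: D_def C'_def)
  then obtain S where S: "\<And>x. x \<in> carrier G \<Longrightarrow> S x \<subseteq> carrier G \<and> finite (S x) \<and> card (S x) \<ge> 2 ^ m \<and>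
      (\<forall>h\<in>S x. gp x \<one> h \<le> C' \<and> ds x h \<le> m * K)"
    by metis
  show ?thesis
  proof (intro exI[of _ "m * K"] allI impI)
    fix F assume F: "finite F" "F \<subseteq> carrier G"
    define FB where "FB = (\<lambda>(x, b). x \<otimes> b) ` (F \<times> ball (m * K))"
    have FB: "finite FB" "FB \<subseteq> carrier G"
      using F finite_ball_simp[of "m * K"] by (auto simp: FB_def ball_def intro!: finite_imageI)
    define N where "N h = {x \<in> carrier G. gp x \<one> h \<le> real C' \<and> ds x h \<le> m * K}" for h
    have N: "finite (N h)" "card (N h) \<le> Suc (m * K) * B" if "h \<in> FB" for h
      using card_near_geodesic_le[of h C' "m * K"] FB that unfolding N_def B_def by auto
    have "card F * 2 ^ m \<le> (\<Sum>x\<in>F. card (S x))"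
      using sum_bounded_below[of F "2 ^ m" "\<lambda>x. card (S x)"] S F by auto
    also have "\<dots> = card (SIGMA x:F. S x)"
      using S F by (subst card_SigmaI) auto
    also have "\<dots> \<le> card (SIGMA h:FB. N h)"
    proof (rule card_inj_on_le[where f = prod.swap])
      show "prod.swap ` (SIGMA x:F. S x) \<subseteq> (SIGMA h:FB. N h)"
      proof clarsimp
        fix x h assume xh: "x \<in> F" "h \<in> S x"
        then have c: "x \<in> carrier G" "h \<in> carrier G" "h \<in> S x" using S F by blast+
        have "h = (\<lambda>(x, b). x \<otimes> b) (x, inv x \<otimes> h)" using c by simp
        moreover have "inv x \<otimes> h \<in> ball (m * K)"
          using S[OF c(1)] c by (auto simp: ball_def ds_def)
        ultimately have "h \<in> FB" using xh unfolding FB_def by blast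
        moreover have "x \<in> N h" using S[OF c(1)] c by (auto simp: N_def)
        ultimately show "h \<in> FB \<and> x \<in> N h" ..
      qed
    qed (use N FB in \<open>auto intro: finite_SigmaI\<close>)
    also have "\<dots> = (\<Sum>h\<in>FB. card (N h))"
      using N FB by (subst card_SigmaI) auto
    also have "\<dots> \<le> card FB * (Suc (m * K) * B)"
      using sum_bounded_above[of FB "\<lambda>h. card (N h)" "Suc (m * K) * B"] N by simp
    finally have "card F * 2 ^ m \<le> card FB * (Suc (m * K) * B)" .
    moreover have "card F * (2 * (Suc (m * K) * B)) \<le> card F * 2 ^ m"
      using m by (rule mult_le_mono2)
    ultimately have "(2 * card F) * (Suc (m * K) * B) \<le> card FB * (Suc (m * K) * B)"
      by (simp only: ac_simps)
    then have "2 * card F \<le> card FB" using B by simp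
    then show "2 * card F \<le> card ((\<lambda>(x, b). x \<otimes> b) ` (F \<times> ball (m * K)))"
      unfolding FB_def .
  qed
qed

end

section \<open>Counting commuting pairs\<close>

text \<open>The exponent is the number of steps of size \<open>k\<close> that fit between
  \<open>n div 2\<close> and \<open>n\<close>. Up to constants the quotient is at most
  \<open>y ^ e / exp y\<close> with \<open>y\<close> growing linearly in \<open>n\<close>.\<close>

lemma polynomial_over_power_tendsto_0:
  assumes "k > 0"
  shows "(\<lambda>n. (real (2 * n + 1)) ^ e / 2 ^ ((n - n div 2) div k)) \<longlonglongrightarrow> 0"
proof (rule tendsto_sandwich[OF _ _ tendsto_const])
  define q where "q n = n div (2 * k)" for n
  \<comment> \<open>The factor 2 compensates for the successor in \<open>y\<close>, which makes
    \<open>exp (y n)\<close> equal to \<open>2 ^ Suc (q n)\<close>.\<close>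
  define f where "f x = (x ^ e / exp x) * (2 * (4 * real k / ln 2) ^ e)" for x :: real
  define y where "y n = real (Suc (q n)) * ln 2" for n
  have "(f \<longlongrightarrow> 0 * (2 * (4 * real k / ln 2) ^ e)) at_top"
    unfolding f_def by (intro tendsto_mult tendsto_power_div_exp_0 tendsto_const)
  moreover have "filterlim y at_top sequentially"
  proof -
    have "filterlim q at_top sequentially"
      unfolding filterlim_at_top
    proof
      fix Z
      have "Z \<le> q n" if "n \<ge> Z * (2 * k)" for n
        using div_le_mono[OF that, of "2 * k"] assms by (simp add: q_def)
      then show "\<forall>\<^sub>F n in sequentially. Z \<le> q n"
        unfolding eventually_sequentially by blast
    qed
    then have "filterlim (\<lambda>n. real (Suc (q n))) at_top sequentially"
      by (intro filterlim_compose[OF filterlim_real_sequentially] filterlim_compose[OF filterlim_Suc])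
    then show ?thesis
      unfolding y_def by (intro filterlim_at_top_mult_tendsto_pos[OF tendsto_const]) auto
  qed
  ultimately show "(\<lambda>n. f (y n)) \<longlonglongrightarrow> 0"
    using filterlim_compose[of f _ at_top y sequentially] by simp
  show "\<forall>\<^sub>F n in sequentially. 0 \<le> real (2 * n + 1) ^ e / 2 ^ ((n - n div 2) div k)"
    by simp
  have "real (2 * n + 1) ^ e / 2 ^ ((n - n div 2) div k) \<le> f (y n)" for n
  proof -
    have "n < 2 * k * Suc (q n)"
      using dividend_less_times_div[of "2 * k" n] assms by (simp add: q_def)
    then have "2 * n + 1 \<le> 4 * k * Suc (q n)" by simp
    then have a: "real (2 * n + 1) \<le> 4 * real k * Suc (q n)"
      by (metis (mono_tags) of_nat_le_iff of_nat_mult of_nat_numeral)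
    have "q n \<le> (n - n div 2) div k"
      unfolding q_def div_mult2_eq by (intro div_le_mono) simp
    then have "real (2 * n + 1) ^ e / 2 ^ ((n - n div 2) div k) \<le> (4 * real k * Suc (q n)) ^ e / 2 ^ q n"
      using a by (intro frac_le power_mono power_increasing) auto
    also have "\<dots> = f (y n)"
    proof -
      have "exp (y n) = 2 ^ Suc (q n)"
        unfolding y_def by (metis exp_ln exp_of_nat_mult zero_less_numeral)
      moreover have "4 * real k * Suc (q n) = y n * (4 * real k / ln 2)"
        by (simp add: y_def)
      then have "(4 * real k * Suc (q n)) ^ e = y n ^ e * (4 * real k / ln 2) ^ e"
        by (simp only: power_mult_distrib)
      ultimately show ?thesis by (simp add: f_def)
    qed
    finally show ?thesis .
  qed
  then show "\<forall>\<^sub>F n in sequentially. real (2 * n + 1) ^ e / 2 ^ ((n - n div 2) div k) \<le> f (y n)"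
    by simp
qed

section \<open>Counting in the balls of an arbitrary finite generating set\<close>

locale hyperbolic_group_two_lengths = hyperbolic_length_group +
  X: length_group G lenX for lenX +
  fixes K K' :: nat
  assumes len_le_lenX: "x \<in> carrier G \<Longrightarrow> len x \<le> K * lenX x"
    and lenX_le_len: "x \<in> carrier G \<Longrightarrow> lenX x \<le> K' * len x"
begin

text \<open>The threshold is that of \<open>conjugate_aligned\<close>: every element outside this
  set is conjugate to an aligned one longer than 20\<delta>.\<close>

definition short_conj :: "'a set" where
  "short_conj = {u \<in> carrier G. \<exists>g\<in>carrier G. len (inv g \<otimes> u \<otimes> g) \<le> 20 * \<delta>}"

text \<open>A vertex \<open>x\<close> of an \<open>X\<close>-geodesic from \<open>\<one>\<close> to \<open>u\<close> lies near the centre \<open>g\<close>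
  of a short conjugator, so that \<open>x\<^sup>-\<^sup>1ux\<close> is short. If \<open>x\<close> is in the second half of the
  geodesic, then \<open>u\<^sup>-\<^sup>1x\<close> takes its place.\<close>

lemma short_conj_subset:
  assumes n: "n \<le> 2 ^ m"
  defines "R \<equiv> 2 * (63 * \<delta> + 1 + m * \<delta> + K) + 20 * \<delta>"
  shows "short_conj \<inter> X.ball n \<subseteq> (\<lambda>(x, v). x \<otimes> v \<otimes> inv x) ` (X.ball (n div 2) \<times> ball R)"
proof
  fix u assume "u \<in> short_conj \<inter> X.ball n"
  then have u: "u \<in> carrier G" "lenX u \<le> n"
    and ex: "\<exists>g\<in>carrier G. len (inv g \<otimes> u \<otimes> g) \<le> 20 * \<delta>"
    by (auto simp: short_conj_def X.ball_def)
  show "u \<in> (\<lambda>(x, v). x \<otimes> v \<otimes> inv x) ` (X.ball (n div 2) \<times> ball R)"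
  proof (cases "lenX u = 0")
    case True
    then have "u = \<one>" using X.len_zero u by simp
    then show ?thesis
      by (intro image_eqI[of _ _ "(\<one>, \<one>)"]) (auto simp: one_in_ball X.one_in_ball)
  next
    case False
    obtain g where g: "g \<in> carrier G" "len (inv g \<otimes> u \<otimes> g) \<le> 20 * \<delta>" "gp g \<one> u \<le> 63 * \<delta> + 1"
      using short_conjugator[OF u(1) ex] by blast
    obtain p where p: "\<And>i. p i \<in> carrier G" "p (lenX u) = u"
      "\<And>i j. i \<le> j \<Longrightarrow> j \<le> lenX u \<Longrightarrow> X.ds (p i) (p j) = j - i"
      "\<And>i. i \<le> lenX u \<Longrightarrow> lenX (p i) = i"
      by (rule X.geodesic[OF u(1)]) (rule that; assumption)
    have p0: "p 0 = \<one>" using p(1) p(4)[of 0] X.len_zero by simp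
    have "\<exists>i<lenX u. gp g (p i) (p (Suc i)) \<le> real (63 * \<delta> + 1) + m * \<delta>"
      using False u(2) n g p0 p(2)
      by (intro path_logarithmically_close[OF p(1) g(1)]) simp_all
    then obtain i where i: "i < lenX u"
      and close: "gp g (p i) (p (Suc i)) \<le> real (63 * \<delta> + 1) + m * \<delta>" by blast
    \<comment> \<open>An edge for \<open>lenX\<close> has bounded length for \<open>len\<close>, so
      the small product on it bounds the distance from \<open>g\<close> to its endpoint.\<close>
    have "ds (p i) (p (Suc i)) \<le> K"
      using len_le_lenX[of "inv (p i) \<otimes> p (Suc i)"] p(3)[of i "Suc i"] p(1) i
      by (simp add: ds_def X.ds_def)
    then have d: "ds g (p i) \<le> 63 * \<delta> + 1 + m * \<delta> + K"
      using gp_ge[OF g(1) p(1) p(1), of i "Suc i"] close by linarith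
    define x where "x = p i"
    define v where "v = inv x \<otimes> u \<otimes> x"
    define r where "r = inv g \<otimes> x"
    have x: "x \<in> carrier G" using p by (simp add: x_def)
    have v: "v \<in> carrier G" using x u by (simp add: v_def)
    have "v = inv r \<otimes> (inv g \<otimes> u \<otimes> g) \<otimes> r"
      using x u g by (simp add: v_def r_def inv_mult_group m_assoc)
    moreover have r: "r \<in> carrier G" "len r \<le> 63 * \<delta> + 1 + m * \<delta> + K"
      using d x g by (simp_all add: r_def ds_def x_def)
    moreover have "len (inv r \<otimes> (inv g \<otimes> u \<otimes> g) \<otimes> r)
        \<le> len r + len (inv g \<otimes> u \<otimes> g) + len r"
      using len_mult[of "inv r \<otimes> (inv g \<otimes> u \<otimes> g)" r] len_mult[of "inv r" "inv g \<otimes> u \<otimes> g"]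
        r g u by (simp add: len_inv)
    ultimately have vb: "v \<in> ball R"
      using g(2) v unfolding R_def ball_def by simp
    show ?thesis
    proof (cases "i \<le> n div 2")
      case True
      have "lenX x = i" using p(4)[of i] i by (simp add: x_def)
      moreover have "u = x \<otimes> v \<otimes> inv x" using x u by (simp add: v_def m_assoc)
      ultimately show ?thesis using x vb True
        by (intro image_eqI[of _ _ "(x, v)"]) (auto simp: X.ball_def)
    next
      case False
      define y where "y = inv u \<otimes> x"
      have y: "y \<in> carrier G" using x u by (simp add: y_def)
      have "lenX y = X.ds u x" by (simp add: y_def X.ds_def)
      also have "\<dots> = lenX u - i"
        using p(3)[of i "lenX u"] p(2) i X.ds_sym[of u x] x u by (simp add: x_def)
      also have "\<dots> \<le> n div 2" using False u(2) by linarith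
      finally have "lenX y \<le> n div 2" .
      moreover have "u = y \<otimes> v \<otimes> inv y"
        using x u by (simp add: y_def v_def m_assoc inv_mult_group)
      ultimately show ?thesis using y vb
        by (intro image_eqI[of _ _ "(y, v)"]) (auto simp: X.ball_def)
    qed
  qed
qed

lemma card_short_conj_le:
  assumes "n \<le> 2 ^ m"
  shows "card (short_conj \<inter> X.ball n)
    \<le> card (X.ball (n div 2)) * card (ball 1) ^ (2 * (63 * \<delta> + 1 + m * \<delta> + K) + 20 * \<delta>)"
    (is "_ \<le> _ * _ ^ ?R")
proof -
  have "card (short_conj \<inter> X.ball n)
      \<le> card ((\<lambda>(x, v). x \<otimes> v \<otimes> inv x) ` (X.ball (n div 2) \<times> ball ?R))"
    using short_conj_subset[OF assms] by (rule card_mono[rotated]) simp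
  also have "\<dots> \<le> card (X.ball (n div 2) \<times> ball ?R)" by (rule card_image_le) simp
  also have "\<dots> \<le> card (X.ball (n div 2)) * card (ball 1) ^ ?R"
    unfolding card_cartesian_product by (intro mult_le_mono2 card_ball_le_power)
  finally show ?thesis .
qed

text \<open>Conjugation by \<open>g\<close> embeds the commuting elements into the centralizer of an
  aligned conjugate of \<open>u\<close>. The factor 3 accounts for \<open>v\<close> and for
  \<open>g\<close> on either side, each of length at most \<open>K * n\<close>.\<close>

lemma card_commuting_le:
  assumes u: "u \<in> X.ball n" "u \<notin> short_conj"
  shows "card {v \<in> X.ball n. u \<otimes> v = v \<otimes> u} \<le> (2 * (3 * K * n) + 1) * card (ball (18 * \<delta>))"
proof -
  have uc: "u \<in> carrier G" "lenX u \<le> n" using u by (auto simp: X.ball_def)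
  have len_le: "len v \<le> K * n" if "v \<in> carrier G" "lenX v \<le> n" for v
    using len_le_lenX[OF that(1)] mult_le_mono2[OF that(2), of K] by (rule le_trans)
  obtain g where g: "g \<in> carrier G" "len g \<le> len u"
    and alt: "len (inv g \<otimes> u \<otimes> g) \<le> 20 * \<delta> \<or>
      gp \<one> (inv (inv g \<otimes> u \<otimes> g)) (inv g \<otimes> u \<otimes> g) \<le> 4 * \<delta>"
    using conjugate_aligned[OF uc(1)] by blast
  define s where "s = inv g \<otimes> u \<otimes> g"
  have long: "len s > 20 * \<delta>" using u(2) uc(1) g(1) unfolding s_def short_conj_def by force
  have s: "s \<in> carrier G" "gp \<one> (inv s) s \<le> 4 * \<delta>"
    using alt long uc g by (auto simp: s_def)
  define A where "A = {c \<in> carrier G. c \<otimes> s = s \<otimes> c \<and> len c \<le> 3 * K * n}"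
  have "card {v \<in> X.ball n. u \<otimes> v = v \<otimes> u} \<le> card A"
  proof (rule card_inj_on_le[where f = "\<lambda>v. inv g \<otimes> v \<otimes> g"])
    show "inj_on (\<lambda>v. inv g \<otimes> v \<otimes> g) {v \<in> X.ball n. u \<otimes> v = v \<otimes> u}"
      using g by (intro inj_onI) (simp add: X.ball_def)
    show "(\<lambda>v. inv g \<otimes> v \<otimes> g) ` {v \<in> X.ball n. u \<otimes> v = v \<otimes> u} \<subseteq> A"
    proof clarify
      fix v assume v: "v \<in> X.ball n" "u \<otimes> v = v \<otimes> u"
      have vc: "v \<in> carrier G" "len v \<le> K * n" using v len_le by (auto simp: X.ball_def)
      have "inv g \<otimes> v \<otimes> g \<otimes> s = inv g \<otimes> (v \<otimes> u) \<otimes> g"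
        using vc uc g by (simp add: s_def m_assoc)
      also have "\<dots> = inv g \<otimes> (u \<otimes> v) \<otimes> g" using v by simp
      also have "\<dots> = s \<otimes> (inv g \<otimes> v \<otimes> g)"
        using vc uc g by (simp add: s_def m_assoc)
      finally have "inv g \<otimes> v \<otimes> g \<otimes> s = s \<otimes> (inv g \<otimes> v \<otimes> g)" .
      moreover have "len (inv g \<otimes> v \<otimes> g) \<le> len g + len v + len g"
        using len_mult[of "inv g \<otimes> v" g] len_mult[of "inv g" v] g vc by (simp add: len_inv)
      then have "len (inv g \<otimes> v \<otimes> g) \<le> 3 * K * n"
        using vc(2) g(2) len_le[OF uc] by simp
      ultimately show "inv g \<otimes> v \<otimes> g \<in> A" using vc g by (simp add: A_def)
    qed
    show "finite A"
      by (rule finite_subset[OF _ finite_ball_simp[of "3 * K * n"]]) (auto simp: A_def ball_def)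
  qed
  also have "\<dots> \<le> (2 * (3 * K * n) + 1) * card (ball (18 * \<delta>))"
    unfolding A_def using card_centralizer_le[OF s long] .
  finally show ?thesis .
qed

text \<open>Elements of \<open>short_conj\<close> are few, so their centralizers may be bounded by
  the whole ball; for all other elements the linear bound applies.\<close>

lemma card_commuting_pairs_le:
  assumes n: "n \<le> 2 ^ m"
  shows "card {(u, v). u \<in> X.ball n \<and> v \<in> X.ball n \<and> u \<otimes> v = v \<otimes> u} \<le>
    card (X.ball n) * (card (X.ball (n div 2)) *
      card (ball 1) ^ (2 * (63 * \<delta> + 1 + m * \<delta> + K) + 20 * \<delta>)
      + (2 * (3 * K * n) + 1) * card (ball (18 * \<delta>)))"
    (is "card ?P \<le> ?b * (?V + ?Z)")
proof -
  define c where "c u = {v \<in> X.ball n. u \<otimes> v = v \<otimes> u}" for u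
  have c: "finite (c u)" "card (c u) \<le> ?b" for u
    unfolding c_def by (auto intro: card_mono)
  let ?S = "short_conj \<inter> X.ball n"
  have "?P = (SIGMA u:X.ball n. c u)" by (auto simp: c_def)
  then have "card ?P = (\<Sum>u\<in>X.ball n. card (c u))"
    using c by (simp add: card_SigmaI)
  also have "\<dots> = (\<Sum>u\<in>X.ball n - ?S. card (c u)) + (\<Sum>u\<in>?S. card (c u))"
    by (rule sum.subset_diff) auto
  also have "(\<Sum>u\<in>X.ball n - ?S. card (c u)) \<le> card (X.ball n - ?S) * ?Z"
    using sum_bounded_above[of "X.ball n - ?S" "\<lambda>u. card (c u)" ?Z] card_commuting_le[of _ n]
    by (auto simp: c_def)
  also have "\<dots> \<le> ?b * ?Z" by (intro mult_le_mono1 card_mono) auto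
  also have "(\<Sum>u\<in>?S. card (c u)) \<le> card ?S * ?b"
    using sum_bounded_above[of ?S "\<lambda>u. card (c u)" ?b] c by auto
  also have "card ?S * ?b \<le> ?V * ?b"
    using card_short_conj_le[OF n] by (rule mult_le_mono1)
  finally show ?thesis by (simp add: algebra_simps)
qed

lemma exponential_growth:
  assumes "\<not> virtually_cyclic G"
  shows "\<exists>k>0. \<forall>n j. 2 ^ j * card (X.ball n) \<le> card (X.ball (n + j * k))"
proof -
  obtain r where r: "\<And>F. finite F \<Longrightarrow> F \<subseteq> carrier G \<Longrightarrow>
    2 * card F \<le> card ((\<lambda>(x, b). x \<otimes> b) ` (F \<times> ball r))"
    using doubling[OF assms] by blast
  \<comment> \<open>\<open>K' * r\<close> is the \<open>lenX\<close>-radius that contains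
    \<open>ball r\<close>; the successor makes \<open>k\<close> a legitimate divisor.\<close>
  define k where "k = Suc (K' * r)"
  have step: "2 * card (X.ball n) \<le> card (X.ball (n + k))" for n
  proof -
    have "2 * card (X.ball n) \<le> card ((\<lambda>(x, b). x \<otimes> b) ` (X.ball n \<times> ball r))"
      by (rule r) (auto simp: X.ball_def intro: X.finite_ball)
    also have "\<dots> \<le> card (X.ball (n + k))"
    proof (rule card_mono)
      show "(\<lambda>(x, b). x \<otimes> b) ` (X.ball n \<times> ball r) \<subseteq> X.ball (n + k)"
      proof clarsimp
        fix x b assume "x \<in> X.ball n" "b \<in> ball r"
        then have xb: "x \<in> carrier G" "lenX x \<le> n" "b \<in> carrier G" "len b \<le> r"
          by (auto simp: X.ball_def ball_def)
        have "lenX b \<le> K' * r"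
          using lenX_le_len[OF xb(3)] mult_le_mono2[OF xb(4), of K'] by (rule le_trans)
        then show "x \<otimes> b \<in> X.ball (n + k)"
          using X.len_mult[OF xb(1,3)] xb by (simp add: X.ball_def k_def)
      qed
    qed simp
    finally show ?thesis .
  qed
  have "2 ^ j * card (X.ball n) \<le> card (X.ball (n + j * k))" for n j
  proof (induction j)
    case (Suc j)
    have "2 ^ Suc j * card (X.ball n) \<le> 2 * card (X.ball (n + j * k))" using Suc by simp
    also have "\<dots> \<le> card (X.ball (n + j * k + k))" by (rule step)
    finally show ?case by (simp add: ac_simps)
  qed simp
  then show ?thesis by (intro exI[of _ k]) (simp add: k_def)
qed

lemma commuting_density_le:
  assumes "\<not> virtually_cyclic G"
  shows "\<exists>k>0. \<exists>e M. \<forall>n.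
    real (card {(u, v). u \<in> X.ball n \<and> v \<in> X.ball n \<and> u \<otimes> v = v \<otimes> u})
      / (real (card (X.ball n)))\<^sup>2 \<le> M * (real (2 * n + 1) ^ e / 2 ^ ((n - n div 2) div k))"
proof -
  obtain k where k: "k > 0" "\<And>n j. 2 ^ j * card (X.ball n) \<le> card (X.ball (n + j * k))"
    using exponential_growth[OF assms] by blast
  define B where "B = card (ball 1)"
  define B' where "B' = card (ball (18 * \<delta>))"
  define c where "c = 2 * (63 * \<delta> + 1 + K) + 20 * \<delta>"
  \<comment> \<open>Since \<open>B ^ (2 * \<delta>)\<close> is at most \<open>2 ^ e\<close>, its
    \<open>m\<close>-th power is at most a power of \<open>2 ^ m\<close>. The successor makes
    \<open>e\<close> positive, so the same power dominates the linear term.\<close>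
  define e where "e = Suc (B ^ (2 * \<delta>))"
  define M where "M = B ^ c + (3 * K + 1) * B'"
  have "real (card {(u, v). u \<in> X.ball n \<and> v \<in> X.ball n \<and> u \<otimes> v = v \<otimes> u})
      / (real (card (X.ball n)))\<^sup>2 \<le> M * (real (2 * n + 1) ^ e / 2 ^ ((n - n div 2) div k))"
    (is "real ?P / (real ?b)\<^sup>2 \<le> _ * (_ / 2 ^ ?j)") for n
  proof -
    \<comment> \<open>Here \<open>m\<close> is the binary logarithm of \<open>n\<close> up to
      rounding; the summand 1 covers \<open>n = 0\<close>.\<close>
    obtain m :: nat where m: "n \<le> 2 ^ m" "2 ^ m \<le> 2 * n + 1"
    proof (cases "n = 0")
      case True
      then show ?thesis using that[of 0] by simp
    next
      case False
      then obtain i where "2 ^ i \<le> n \<and> n < 2 ^ (i + 1)" using ex_power_ivl1[of 2 n] by auto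
      then show ?thesis using that[of "i + 1"] by simp
    qed
    have "2 * (63 * \<delta> + 1 + m * \<delta> + K) + 20 * \<delta> = c + 2 * \<delta> * m"
      by (simp add: c_def algebra_simps)
    then have "B ^ (2 * (63 * \<delta> + 1 + m * \<delta> + K) + 20 * \<delta>) = B ^ c * (B ^ (2 * \<delta>)) ^ m"
      by (simp only: power_add power_mult)
    also have "\<dots> \<le> B ^ c * (2 ^ e) ^ m"
    proof (intro mult_le_mono2 power_mono)
      have "B ^ (2 * \<delta>) < 2 ^ (B ^ (2 * \<delta>))" by (rule less_exp)
      then show "B ^ (2 * \<delta>) \<le> 2 ^ e" unfolding e_def power_Suc by linarith
    qed simp
    also have "((2 :: nat) ^ e) ^ m = (2 ^ m) ^ e" by (simp only: power_mult[symmetric] mult.commute)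
    also have "B ^ c * (2 ^ m) ^ e \<le> B ^ c * (2 * n + 1) ^ e"
      using m(2) by (intro mult_le_mono2 power_mono) auto
    finally have V: "B ^ (2 * (63 * \<delta> + 1 + m * \<delta> + K) + 20 * \<delta>) \<le> B ^ c * (2 * n + 1) ^ e" .
    have "2 * (3 * K * n) + 1 \<le> (3 * K + 1) * (2 * n + 1)"
      by (simp add: algebra_simps)
    also have "\<dots> \<le> (3 * K + 1) * (2 * n + 1) ^ e"
      by (intro mult_le_mono2 self_le_power) (simp_all add: e_def)
    finally have Z: "(2 * (3 * K * n) + 1) * B' \<le> (3 * K + 1) * (2 * n + 1) ^ e * B'"
      by (rule mult_le_mono1)
    define h where "h = card (X.ball (n div 2))"
    have h: "h > 0" unfolding h_def by (rule X.card_ball_pos)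
    have b: "?b > 0" by (rule X.card_ball_pos)
    \<comment> \<open>There is room for \<open>?j\<close> doublings between the ball of half the
      radius and the full ball.\<close>
    have "n div 2 + ?j * k \<le> n"
      using div_times_less_eq_dividend[of "n - n div 2" k] by linarith
    then have "card (X.ball (n div 2 + ?j * k)) \<le> ?b"
      by (intro card_mono X.ball_mono) auto
    then have growth: "2 ^ ?j * h \<le> ?b" using k(2)[of ?j "n div 2"] unfolding h_def by simp
    have "?P \<le> ?b * (h * B ^ (2 * (63 * \<delta> + 1 + m * \<delta> + K) + 20 * \<delta>)
        + (2 * (3 * K * n) + 1) * B')"
      using card_commuting_pairs_le[OF m(1)] unfolding h_def B_def B'_def .
    also have "\<dots> \<le> ?b * (h * (B ^ c * (2 * n + 1) ^ e) + h * ((3 * K + 1) * (2 * n + 1) ^ e * B'))"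
    proof (intro mult_le_mono2 add_mono mult_le_mono2 V)
      show "(2 * (3 * K * n) + 1) * B' \<le> h * ((3 * K + 1) * (2 * n + 1) ^ e * B')"
        using Z h by (metis Suc_leI le_trans mult_le_mono1 nat_mult_1 One_nat_def)
    qed
    also have "\<dots> = ?b * (h * (M * (2 * n + 1) ^ e))"
      by (simp add: M_def algebra_simps)
    finally have "?P * 2 ^ ?j \<le> ?b * (h * (M * (2 * n + 1) ^ e)) * 2 ^ ?j"
      by (rule mult_le_mono1)
    also have "\<dots> = ?b * (2 ^ ?j * h) * (M * (2 * n + 1) ^ e)" by simp
    also have "\<dots> \<le> ?b * ?b * (M * (2 * n + 1) ^ e)"
      using growth by (intro mult_le_mono1 mult_le_mono2)
    finally have "real (?P * 2 ^ ?j) \<le> real (?b * ?b * (M * (2 * n + 1) ^ e))"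
      by (simp only: of_nat_le_iff)
    then have "real ?P * 2 ^ ?j \<le> (real M * real (2 * n + 1) ^ e) * (real ?b)\<^sup>2"
      by (simp add: power2_eq_square ac_simps)
    moreover have frac: "p / q \<le> a * (x / t)" if "p * t \<le> (a * x) * q" "q > 0" "t > 0" for a p q t x :: real
      using that by (simp add: field_simps)
    ultimately show ?thesis using b by (intro frac zero_less_power of_nat_0_less_iff[THEN iffD2]) simp_all
  qed
  then show ?thesis using k(1) by blast
qed

lemma commuting_density_tendsto_0:
  assumes "\<not> virtually_cyclic G"
  shows "(\<lambda>n. real (card {(u, v). u \<in> X.ball n \<and> v \<in> X.ball n \<and> u \<otimes> v = v \<otimes> u})
      / (real (card (X.ball n)))\<^sup>2) \<longlonglongrightarrow> 0"
proof -
  obtain k e M where k: "k > 0" and le: "\<And>n.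
    real (card {(u, v). u \<in> X.ball n \<and> v \<in> X.ball n \<and> u \<otimes> v = v \<otimes> u})
      / (real (card (X.ball n)))\<^sup>2 \<le> M * (real (2 * n + 1) ^ e / 2 ^ ((n - n div 2) div k))"
    using commuting_density_le[OF assms] by blast
  have "(\<lambda>n. M * (real (2 * n + 1) ^ e / 2 ^ ((n - n div 2) div k))) \<longlonglongrightarrow> M * 0"
    by (intro tendsto_mult tendsto_const polynomial_over_power_tendsto_0 k)
  then have lim: "(\<lambda>n. M * (real (2 * n + 1) ^ e / 2 ^ ((n - n div 2) div k))) \<longlonglongrightarrow> 0"
    by simp
  show ?thesis
    by (rule tendsto_sandwich[OF _ _ tendsto_const lim]; intro always_eventually allI)
       (simp, rule le)
qed

end

theorem theorem1p9:
  fixes G :: "('a, 'b) monoid_scheme" and X :: "'a set"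
  assumes "hyperbolic_group G"
    and "non_elementary G"
    and "finite X"
    and "generating_set G X"
  shows "degree_of_commutativity G X = 0"
proof -
  interpret group G using assms(1) by (simp add: hyperbolic_group_def)
  obtain Y \<delta>\<^sub>0 where Y: "finite Y" "generating_set G Y" and
    hyp: "\<And>w x y z. w \<in> carrier G \<Longrightarrow> x \<in> carrier G \<Longrightarrow> y \<in> carrier G \<Longrightarrow> z \<in> carrier G \<Longrightarrow>
      gromov_product G Y w x z \<ge> min (gromov_product G Y w x y) (gromov_product G Y w y z) - \<delta>\<^sub>0"
    using assms(1) unfolding hyperbolic_group_def by blast
  interpret Y: length_group G "word_length G Y"
    using is_group Y by (rule length_group_word_length)
  interpret X: length_group G "word_length G X"
    using is_group assms(3,4) by (rule length_group_word_length)
  have gp: "gromov_product G Y = Y.gp"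
    by (intro ext) (simp add: gromov_product_def Y.gp_def word_dist_def Y.ds_def)
  obtain K where K: "\<And>x. x \<in> carrier G \<Longrightarrow> word_length G Y x \<le> K * word_length G X x"
    using X.subadditive_le_len[OF Y.len_one Y.len_mult] by blast
  obtain K' where K': "\<And>x. x \<in> carrier G \<Longrightarrow> word_length G X x \<le> K' * word_length G Y x"
    using Y.subadditive_le_len[OF X.len_one X.len_mult] by blast
  \<comment> \<open>Rounding up and adding one yields a positive integer that still serves as a
    hyperbolicity constant.\<close>
  define \<delta> where "\<delta> = Suc (nat \<lceil>\<delta>\<^sub>0\<rceil>)"
  have \<delta>: "\<delta>\<^sub>0 \<le> real \<delta>" unfolding \<delta>_def by linarith
  interpret hyperbolic_group_two_lengths G "word_length G Y" \<delta> "word_length G X" K K'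
  proof
    fix w x y z assume "w \<in> carrier G" "x \<in> carrier G" "y \<in> carrier G" "z \<in> carrier G"
    from hyp[OF this] show "min (Y.gp w x y) (Y.gp w y z) - \<delta> \<le> Y.gp w x z"
      using \<delta> by (simp add: gp)
  qed (use K K' in \<open>simp_all add: \<delta>_def\<close>)
  have "word_ball G X n = X.ball n" for n by (simp add: word_ball_def X.ball_def)
  then have "(\<lambda>n. ereal (real (card {(u, v). u \<in> word_ball G X n \<and> v \<in> word_ball G X n
        \<and> u \<otimes>\<^bsub>G\<^esub> v = v \<otimes>\<^bsub>G\<^esub> u}) / (real (card (word_ball G X n)))\<^sup>2)) \<longlonglongrightarrow> ereal 0"
    using commuting_density_tendsto_0 assms(2) by (simp add: non_elementary_def)
  then show ?thesis
    unfolding degree_of_commutativity_def zero_ereal_def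
    by (rule lim_imp_Limsup[OF sequentially_bot])
qed

end
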